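(* Let $\mathcal{I}$ be a fractional ideal of the local ring $\mathcal{O}$ of an algebroid curve, let $G$ be a fixed Standard Basis for $\mathcal{O}$, and let $H$ be a Standard Basis for $\mathcal{I}$. Then the relative ideal $v(\mathcal{I})$ is a $\Gamma$-semimodule generated by the finite set $v(H)=\{v(h):h\in H\}$; that is, writing $v(H)=\{\lambda_1,\ldots,\lambda_s\}$, every $\lambda\in v(\mathcal{I})$ can be written as $$\lambda=(\gamma_1\odot\lambda_1)\oplus\cdots\oplus(\gamma_s\odot\lambda_s)=\inf\{\gamma_1+\lambda_1,\ldots,\gamma_s+\lambda_s\}$$ with $\gamma_1,\ldots,\gamma_s\in\Gamma$.
   Context: Setting. $\mathbb{K}$ is an algebraically closed field. $(\mathcal{O},\mathcal{M},\mathbb{K})$ is a one-dimensional complete Noetherian local ring with coefficient field $\mathbb{K}$, $\mathcal{O}=\mathbb{K}[[X_1,\ldots,X_n]]/Q$ with $Q$ a proper radical ideal and $n=\dim_{\mathbb{K}}\mathcal{M}/\mathcal{M}^2$; one calls $Q$ an algebroid curve and $\mathcal{O}$ its local ring. Write $Q=\bigcap_{i\in I}P_i$, $I=\{1,\ldots,r\}$, with $P_i$ the distinct minimal primes over $Q$ (branches), each with $\mathcal{O}_i=\mathbb{K}[[X_1,\ldots,X_n]]/P_i$ of dimension one. The integral closure of $\mathcal{O}_i$ in its fraction field $\mathcal{Q}_i$ is a discrete valuation ring $\overline{\mathcal{O}_i}=\mathbb{K}[[t_i]]$. The total ring of fractions of $\mathcal{O}$ is $\mathcal{Q}=\bigoplus_{i\in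 I}\mathcal{Q}_i=\bigoplus_{i\in I}\mathbb{K}((t_i))$, and $\mathcal{O}\hookrightarrow\mathcal{Q}$ by $g\mapsto(g_1,\ldots,g_r)$, $g_i$ the image of $g$ in $\mathcal{O}_i$. For $h=(h_1,\ldots,h_r)\in\mathcal{Q}$ put $v_i(h)=\operatorname{ord}_{t_i}(h_i)\in\mathbb{Z}\cup\{\infty\}$ ($v_i(h)=\infty$ if $h_i=0$) and $v(h)=(v_1(h),\ldots,v_r(h))$. A fractional ideal of $\mathcal{O}$ means a finitely generated $\mathcal{O}$-submodule of $\mathcal{Q}$ containing a non zero divisor of $\mathcal{Q}$. Values. $\Gamma=v(\mathcal{O})=\{v(g):g\in\mathcal{O}\}$ (including $v(0)=(\infty,\ldots,\infty)$) is a commutative semiring with $\alpha\oplus\beta=\inf\{\alpha,\beta\}$ (componentwise minimum) and $\alpha\odot\beta=\alpha+\beta$ (with $a+\infty=\infty$). The relative ideal of $\mathcal{I}$ is $v(\mathcal{I})=\{v(h):h\in\mathcal{I}\}$, with $\lambda\oplus\lambda'=\inf\{\lambda,\lambda'\}$ and $\gamma\odot\lambda=\gamma+\lambda$ for $\lambda,\lambda'\in v(\mathcal{I})$, $\gamma\in\Gamma$; these operations make $v(\mathcal{I})$ a $\Gamma$-semimodule. Reductions. Let $G\subset\mathcal{M}\setminus\{0\}$ be finite and $H\subset\mathcal{Q}\setminus\{0\}$. A $G$-product is an element $G^{\alpha}=\prod_{g_i\in G}g_i^{\alpha_i}$ with $\alpha_i\in\mathbb{N}=\{0,1,2,\ldots\}$.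 For nonzero $f\in\mathcal{Q}$ and $k\in I_f:=\{i\in I: v_i(f)\neq\infty\}$, an element $f'$ is a $k$-reduction of $f$ modulo $(H,G)$ if there are $c\in\mathbb{K}$, $h\in H$ and a $G$-product $G^\alpha$ with $f'=f-cG^\alpha h$, $v_i(f')\ge v_i(f)$ for all $i\in I$ and $v_k(f')>v_k(f)$. A reduction of $f$ modulo $(H,G)$ is a $k$-reduction for some $k\in I_f$. A Standard Basis for $\mathcal{O}$ is a finite set $G\subset\mathcal{M}\setminus\{0\}$ such that every nonzero element of $\mathcal{O}$ admits a reduction modulo $(\{1\},G)$. With $G$ fixed, a Standard Basis for a fractional ideal $\mathcal{I}$ is a finite set $H\subset\mathcal{I}\setminus\{0\}$ such that every nonzero element of $\mathcal{I}$ admits a reduction modulo $(H,G)$. *)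

theory Defs
  imports
    "HOL-Computational_Algebra.Computational_Algebra"
    "HOL-Library.Function_Algebras"
    "HOL-Library.Cardinality"
    "HOL-Library.Extended"
    "HOL-Library.Extended_Nat"
    "HOL-Algebra.Ideal_Product"
    "HOL-Algebra.Embedded_Algebras"
    "HOL-Algebra.QuotRing"
begin

text \<open>
  The variables are indexed by the finite type \<open>'n\<close>, so that \<open>mps\<close> is
  \<open>K[[X_1,...,X_n]]\<close> with \<open>n = CARD('n)\<close>. A series is its family of coefficients,
  indexed by exponent vectors; the order on exponent vectors is componentwise.
\<close>

definition mps_mult ::
    "(('n::finite \<Rightarrow> nat) \<Rightarrow> 'k::field) \<Rightarrow> (('n \<Rightarrow> nat) \<Rightarrow> 'k) \<Rightarrow> ('n \<Rightarrow> nat) \<Rightarrow> 'k"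
  where "mps_mult f g = (\<lambda>e. \<Sum>a\<in>{..e}. f a * g (\<lambda>i. e i - a i))"

definition mps_const :: "'k::field \<Rightarrow> ('n::finite \<Rightarrow> nat) \<Rightarrow> 'k"
  where "mps_const c = (\<lambda>e. if e = (\<lambda>_. 0) then c else 0)"

definition mps :: "(('n::finite \<Rightarrow> nat) \<Rightarrow> 'k::field) ring"
  where "mps = \<lparr>carrier = UNIV, mult = mps_mult, one = mps_const 1,
                zero = (\<lambda>_. 0), add = (\<lambda>f g e. f e + g e)\<rparr>"

lemma finite_atMost_exponent: "finite {..e :: 'n::finite \<Rightarrow> nat}"
proof (rule finite_subset)
  show "{..e} \<subseteq> PiE UNIV (\<lambda>i. {..e i})"
    by (auto simp: le_fun_def)
  show "finite (PiE UNIV (\<lambda>i. {..e i}))"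
    by (intro finite_PiE) auto
qed

lemma mps_mult_commute: "mps_mult f g = mps_mult g f"
proof
  fix e
  show "mps_mult f g e = mps_mult g f e"
    unfolding mps_mult_def
    by (rule sum.reindex_bij_witness[of _ "\<lambda>a i. e i - a i" "\<lambda>a i. e i - a i"])
       (auto simp: le_fun_def fun_eq_iff mult.commute)
qed

lemma mps_mult_assoc: "mps_mult (mps_mult f g) h = mps_mult f (mps_mult g h)"
proof
  fix e :: "'a \<Rightarrow> nat"
  let ?S = "SIGMA a:{..e}. {..a}" and ?T = "SIGMA b:{..e}. {..(\<lambda>i. e i - b i)}"
  have "mps_mult (mps_mult f g) h e =
      (\<Sum>(a, b)\<in>?S. f b * g (\<lambda>i. a i - b i) * h (\<lambda>i. e i - a i))"
    unfolding mps_mult_def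
    by (simp add: sum.Sigma finite_atMost_exponent sum_distrib_right)
  also have "\<dots> = (\<Sum>(b, c)\<in>?T. f b * (g c * h (\<lambda>i. e i - b i - c i)))"
  proof (rule sum.reindex_bij_witness[of _ "\<lambda>(b, c). (\<lambda>i. b i + c i, b)"
        "\<lambda>(a, b). (b, \<lambda>i. a i - b i)"], goal_cases)
    case (2 x)
    then show ?case
      by (auto simp: le_fun_def diff_le_mono intro: order_trans)
  next
    case (4 x)
    then show ?case
      by (auto simp: le_fun_def) (metis add.commute le_diff_conv2)
  next
    case (5 x)
    then obtain a b where x: "x = (a, b)" and ab: "a \<le> e" "b \<le> a"
      by auto
    have "(\<lambda>i. e i - b i - (a i - b i)) = (\<lambda>i. e i - a i)"
      using ab by (auto simp: le_fun_def fun_eq_iff)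
    then show ?case
      by (simp add: x mult.assoc)
  qed (auto simp: le_fun_def fun_eq_iff)
  also have "\<dots> = mps_mult f (mps_mult g h) e"
    unfolding mps_mult_def
    by (simp add: sum.Sigma finite_atMost_exponent sum_distrib_left)
  finally show "mps_mult (mps_mult f g) h e = mps_mult f (mps_mult g h) e" .
qed

lemma mps_mult_one: "mps_mult (mps_const 1) f = f"
proof
  fix e
  have "mps_mult (mps_const 1) f e = (\<Sum>a\<in>{..e}. if a = (\<lambda>_. 0) then f e else 0)"
    unfolding mps_mult_def mps_const_def by (intro sum.cong) auto
  also have "\<dots> = f e"
    by (subst sum.delta) (auto simp: finite_atMost_exponent le_fun_def)
  finally show "mps_mult (mps_const 1) f e = f e" .
qed

lemma cring_mps: "cring (mps :: (('n::finite \<Rightarrow> nat) \<Rightarrow> 'k::field) ring)"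
proof (rule cringI)
  show "abelian_group (mps :: (('n \<Rightarrow> nat) \<Rightarrow> 'k) ring)"
  proof (rule abelian_groupI)
    fix f :: "('n \<Rightarrow> nat) \<Rightarrow> 'k"
    show "\<exists>g\<in>carrier mps. g \<oplus>\<^bsub>mps\<^esub> f = \<zero>\<^bsub>mps\<^esub>"
      by (rule bexI[of _ "\<lambda>e. - f e"]) (simp_all add: mps_def)
  qed (simp_all add: mps_def add_ac)
  show "comm_monoid (mps :: (('n \<Rightarrow> nat) \<Rightarrow> 'k) ring)"
    by (rule comm_monoidI)
       (simp_all add: mps_def mps_mult_assoc mps_mult_one, rule mps_mult_commute)
qed (simp add: mps_def mps_mult_def distrib_right sum.distrib)

definition radical_ideal :: "'a set \<Rightarrow> ('a, 'b) ring_scheme \<Rightarrow> bool"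
  where "radical_ideal Q R \<longleftrightarrow> ideal Q R \<and>
    (\<forall>f\<in>carrier R. \<forall>m::nat. f [^]\<^bsub>R\<^esub> m \<in> Q \<longrightarrow> f \<in> Q)"

definition minimal_primes :: "('a, 'b) ring_scheme \<Rightarrow> 'a set \<Rightarrow> 'a set set"
  where "minimal_primes R Q = {P. primeideal P R \<and> Q \<subseteq> P \<and>
    (\<forall>P'. primeideal P' R \<and> Q \<subseteq> P' \<and> P' \<subseteq> P \<longrightarrow> P' = P)}"

definition krull_dim :: "('a, 'b) ring_scheme \<Rightarrow> enat"
  where "krull_dim R = Sup {enat d |d. \<exists>p :: nat \<Rightarrow> 'a set.
    (\<forall>i\<le>d. primeideal (p i) R) \<and> (\<forall>i<d. p i \<subset> p (Suc i))}"

definition integral_closure :: "'a::comm_ring_1 set \<Rightarrow> 'a set"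
  where "integral_closure A =
    {x. \<exists>p. lead_coeff p = 1 \<and> (\<forall>i. poly.coeff p i \<in> A) \<and> poly p x = 0}"

definition fls_ring :: "'k::field fls ring"
  where "fls_ring = \<lparr>carrier = UNIV, mult = (*), one = 1, zero = 0, add = (+)\<rparr>"

text \<open>
  \<open>M/M^2\<close> has \<open>K\<close>-dimension \<open>d\<close>, where \<open>M\<close> is an ideal of \<open>O = mps Quot Q\<close>.
  Both \<open>M/M^2\<close> and (the image of) \<open>K\<close> are regarded as subsets of the ring \<open>O/M^2\<close>.
\<close>

definition cotangent_dim ::
    "(('n::finite \<Rightarrow> nat) \<Rightarrow> 'k::field) set \<Rightarrow> (('n \<Rightarrow> nat) \<Rightarrow> 'k) set set \<Rightarrow> nat \<Rightarrow> bool"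
  where "cotangent_dim Q M d \<longleftrightarrow>
    (let R = mps Quot Q; M2 = M \<cdot>\<^bsub>R\<^esub> M in
      ring.dimension (R Quot M2) d
        (range (\<lambda>c. M2 +>\<^bsub>R\<^esub> (Q +>\<^bsub>mps\<^esub> mps_const c)))
        ((\<lambda>m. M2 +>\<^bsub>R\<^esub> m) ` M))"

text \<open>
  An identification, over \<open>K\<close>, of the fraction field of \<open>O_P = mps Quot P\<close> with \<open>K((t))\<close>
  under which the integral closure of \<open>O_P\<close> is \<open>K[[t]]\<close>.
  It is given by its restriction \<open>\<phi>\<close> to \<open>O_P\<close>.
\<close>

definition normalization ::
    "(('n::finite \<Rightarrow> nat) \<Rightarrow> 'k::field) set \<Rightarrow> ((('n \<Rightarrow> nat) \<Rightarrow> 'k) set \<Rightarrow> 'k fls) \<Rightarrow> bool"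
  where "normalization P \<phi> \<longleftrightarrow>
    (let A = \<phi> ` carrier (mps Quot P) in
      \<phi> \<in> ring_hom (mps Quot P) fls_ring \<and>
      inj_on \<phi> (carrier (mps Quot P)) \<and>
      (\<forall>c. \<phi> (P +>\<^bsub>mps\<^esub> mps_const c) = fls_const c) \<and>
      (\<forall>z. \<exists>a\<in>A. \<exists>b\<in>A. b \<noteq> 0 \<and> z = a / b) \<and>
      integral_closure A = range fps_to_fls)"

text \<open>
  The branches are indexed by the finite type \<open>'r\<close>. The last two assumptions on the
  primes \<open>P i\<close> follow from the preceding ones.
\<close>

locale algebroid_curve =
  fixes Q :: "(('n::finite \<Rightarrow> nat) \<Rightarrow> 'k::alg_closed_field) set"
    and M :: "(('n \<Rightarrow> nat) \<Rightarrow> 'k) set set"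
    and P :: "'r::finite \<Rightarrow> (('n \<Rightarrow> nat) \<Rightarrow> 'k) set"
    and \<phi> :: "'r \<Rightarrow> (('n \<Rightarrow> nat) \<Rightarrow> 'k) set \<Rightarrow> 'k fls"
  assumes radical: "radical_ideal Q mps"
    and proper: "Q \<noteq> carrier mps"
    and dim_one: "krull_dim (mps Quot Q) = 1"
    and local_ring: "{J. maximalideal J (mps Quot Q)} = {M}"
    and embedding_dim: "cotangent_dim Q M CARD('n)"
    and branches: "bij_betw P UNIV (minimal_primes mps Q)"
    and Int_branches: "Q = (\<Inter>i. P i)"
    and branch_dim_one: "\<And>i. krull_dim (mps Quot P i) = 1"
    and branch_normalization: "\<And>i. normalization (P i) (\<phi> i)"

text \<open>
  The total ring of fractions, the product of the fields \<open>K((t_i))\<close>, is the type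
  \<open>'r \<Rightarrow> 'k fls\<close> with pointwise operations. The map \<open>embed P \<phi>\<close> is the canonical embedding
  of \<open>mps Quot Q\<close>; note that \<open>P i <+> g\<close> is the image in \<open>mps Quot P i\<close> of the coset \<open>g\<close> of
  \<open>Q \<subseteq> P i\<close>.
\<close>

definition embed ::
    "('r \<Rightarrow> (('n::finite \<Rightarrow> nat) \<Rightarrow> 'k::field) set) \<Rightarrow>
     ('r \<Rightarrow> (('n \<Rightarrow> nat) \<Rightarrow> 'k) set \<Rightarrow> 'k fls) \<Rightarrow>
     (('n \<Rightarrow> nat) \<Rightarrow> 'k) set \<Rightarrow> 'r \<Rightarrow> 'k fls"
  where "embed P \<phi> g = (\<lambda>i. \<phi> i (P i <+>\<^bsub>mps\<^esub> g))"

definition val :: "('r \<Rightarrow> 'k::field fls) \<Rightarrow> 'r \<Rightarrow> int extended"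
  where "val h = (\<lambda>i. if h i = 0 then Pinf else Fin (fls_subdegree (h i)))"

definition fractional_ideal ::
    "('r \<Rightarrow> 'k::field fls) set \<Rightarrow> ('r \<Rightarrow> 'k fls) set \<Rightarrow> bool"
  where "fractional_ideal \<O> \<I> \<longleftrightarrow>
    (\<exists>S. finite S \<and> \<I> = {\<Sum>s\<in>S. a s * s |a. \<forall>s\<in>S. a s \<in> \<O>}) \<and>
    (\<exists>h\<in>\<I>. \<forall>x. h * x = 0 \<longrightarrow> x = 0)"

definition k_reduction ::
    "('r \<Rightarrow> 'k::field fls) set \<Rightarrow> ('r \<Rightarrow> 'k fls) set \<Rightarrow>
     'r \<Rightarrow> ('r \<Rightarrow> 'k fls) \<Rightarrow> ('r \<Rightarrow> 'k fls) \<Rightarrow> bool"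
  where "k_reduction H G k f f' \<longleftrightarrow>
    f \<noteq> 0 \<and> val f k \<noteq> Pinf \<and>
    (\<exists>c. \<exists>h\<in>H. \<exists>\<alpha> :: ('r \<Rightarrow> 'k fls) \<Rightarrow> nat.
      f' = f - (\<lambda>_. fls_const c) * (\<Prod>g\<in>G. g ^ \<alpha> g) * h) \<and>
    (\<forall>i. val f' i \<ge> val f i) \<and> val f' k > val f k"

definition reduction ::
    "('r \<Rightarrow> 'k::field fls) set \<Rightarrow> ('r \<Rightarrow> 'k fls) set \<Rightarrow>
     ('r \<Rightarrow> 'k fls) \<Rightarrow> ('r \<Rightarrow> 'k fls) \<Rightarrow> bool"
  where "reduction H G f f' \<longleftrightarrow> (\<exists>k. k_reduction H G k f f')"

definition standard_basis_ring ::
    "('r \<Rightarrow> 'k::field fls) set \<Rightarrow> ('r \<Rightarrow> 'k fls) set \<Rightarrow> ('r \<Rightarrow> 'k fls) set \<Rightarrow> bool"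
  where "standard_basis_ring \<O> \<M> G \<longleftrightarrow>
    finite G \<and> G \<subseteq> \<M> - {0} \<and> (\<forall>f\<in>\<O> - {0}. \<exists>f'. reduction {1} G f f')"

definition standard_basis_ideal ::
    "('r \<Rightarrow> 'k::field fls) set \<Rightarrow> ('r \<Rightarrow> 'k fls) set \<Rightarrow> ('r \<Rightarrow> 'k fls) set \<Rightarrow> bool"
  where "standard_basis_ideal G \<I> H \<longleftrightarrow>
    finite H \<and> H \<subseteq> \<I> - {0} \<and> (\<forall>f\<in>\<I> - {0}. \<exists>f'. reduction H G f f')"

locale semimodule = R?: semiring R + R?: comm_monoid R + M?: abelian_monoid M
  for R and M (structure) +
  assumes smult_closed:
      "\<lbrakk>a \<in> carrier R; x \<in> carrier M\<rbrakk> \<Longrightarrow> a \<odot>\<^bsub>M\<^esub> x \<in> carrier M"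
    and smult_l_distr:
      "\<lbrakk>a \<in> carrier R; b \<in> carrier R; x \<in> carrier M\<rbrakk> \<Longrightarrow>
        (a \<oplus>\<^bsub>R\<^esub> b) \<odot>\<^bsub>M\<^esub> x = (a \<odot>\<^bsub>M\<^esub> x) \<oplus>\<^bsub>M\<^esub> (b \<odot>\<^bsub>M\<^esub> x)"
    and smult_r_distr:
      "\<lbrakk>a \<in> carrier R; x \<in> carrier M; y \<in> carrier M\<rbrakk> \<Longrightarrow>
        a \<odot>\<^bsub>M\<^esub> (x \<oplus>\<^bsub>M\<^esub> y) = (a \<odot>\<^bsub>M\<^esub> x) \<oplus>\<^bsub>M\<^esub> (a \<odot>\<^bsub>M\<^esub> y)"
    and smult_assoc:
      "\<lbrakk>a \<in> carrier R; b \<in> carrier R; x \<in> carrier M\<rbrakk> \<Longrightarrow>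
        (a \<otimes>\<^bsub>R\<^esub> b) \<odot>\<^bsub>M\<^esub> x = a \<odot>\<^bsub>M\<^esub> (b \<odot>\<^bsub>M\<^esub> x)"
    and smult_one: "x \<in> carrier M \<Longrightarrow> \<one>\<^bsub>R\<^esub> \<odot>\<^bsub>M\<^esub> x = x"
    and smult_l_null: "x \<in> carrier M \<Longrightarrow> \<zero>\<^bsub>R\<^esub> \<odot>\<^bsub>M\<^esub> x = \<zero>\<^bsub>M\<^esub>"
    and smult_r_null: "a \<in> carrier R \<Longrightarrow> a \<odot>\<^bsub>M\<^esub> \<zero>\<^bsub>M\<^esub> = \<zero>\<^bsub>M\<^esub>"

definition value_semiring :: "('r \<Rightarrow> int extended) set \<Rightarrow> ('r \<Rightarrow> int extended) ring"
  where "value_semiring \<Gamma> = \<lparr>carrier = \<Gamma>, mult = (+), one = 0, zero = (\<lambda>_. Pinf), add = inf\<rparr>"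

text \<open>The fields \<open>mult\<close> and \<open>one\<close> of the record carry no meaning for a semimodule.\<close>

definition value_semimodule ::
    "('r \<Rightarrow> int extended) set \<Rightarrow> ('r \<Rightarrow> int extended, 'r \<Rightarrow> int extended) module"
  where "value_semimodule \<Lambda> = \<lparr>carrier = \<Lambda>, mult = undefined, one = undefined,
    zero = (\<lambda>_. Pinf), add = inf, smult = (+)\<rparr>"

end

theory Submission
  imports Defs
begin

text \<open>
  The heart of the matter is that every \<open>f \<in> \<I>\<close> and every branch \<open>k\<close> with \<open>f\<^sub>k \<noteq> 0\<close> admit
  \<open>a \<in> \<O>\<close> and \<open>h \<in> H\<close> with \<open>v(a h) \<ge> v(f)\<close> and \<open>v\<^sub>k(a h) = v\<^sub>k(f)\<close>; the infimum of these
  values over \<open>k\<close> is \<open>v(f)\<close>. A Standard Basis only provides a reduction at some branch. If it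
  raises \<open>v\<^sub>k\<close>, the subtracted element is the required one; otherwise \<open>f\<close> is replaced by its
  reduction. This process stops because \<open>\<I>\<close> contains a conductor: a component \<open>f\<^sub>i\<close> with \<open>i \<noteq> k\<close>
  whose order has grown large can be subtracted within \<open>\<I>\<close>.

  The conductor of a branch comes from two elements of the maximal ideal of \<open>\<O>\<^sub>i\<close> with consecutive
  orders, which exist because \<open>t\<close> is a quotient of elements of \<open>\<O>\<^sub>i\<close>: their products have every
  large order, and \<open>\<O>\<^sub>i\<close> is complete. It is moved into \<open>\<O>\<close> by an element of \<open>\<O>\<close> vanishing on
  all the other branches. The values are closed under infima because \<open>K\<close> is infinite.
\<close>

section \<open>Preliminaries: infinite fields and orders of Laurent series\<close>

unbundle fps_syntax

text \<open>Over a finite field the product of all \<open>X - a\<close> vanishes at every point, so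
  adding 1 gives a polynomial of positive degree without a root.\<close>

lemma infinite_alg_closed_field: "infinite (UNIV :: 'k::alg_closed_field set)"
proof
  assume fin: "finite (UNIV :: 'k set)"
  define q :: "'k poly" where "q = (\<Prod>a\<in>UNIV. [:- a, 1:])"
  have q_degree: "degree q = card (UNIV :: 'k set)"
    unfolding q_def by (subst degree_prod_eq_sum_degree) simp_all
  have "degree (q + 1) = degree q"
    using q_degree fin by (intro degree_add_eq_left) (simp add: finite_UNIV_card_ge_0)
  then have "degree (q + 1) > 0"
    using q_degree fin by (simp add: finite_UNIV_card_ge_0)
  then obtain x where "poly (q + 1) x = 0"
    using alg_closed_imp_poly_has_root by blast
  moreover have "poly q x = 0"
    unfolding q_def poly_prod using fin by (intro prod_zero) auto
  ultimately show False
    by simp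
qed

lemma sum_fun_apply: "(\<Sum>x\<in>S. F x) y = (\<Sum>x\<in>S. F x y)"
  by (induction S rule: infinite_finite_induct) simp_all

text \<open>Stated by coefficients so that 0 meets every bound, in spite of the convention
  \<open>fls_subdegree 0 = 0\<close>.\<close>

definition fls_order_ge :: "int \<Rightarrow> 'k::field fls \<Rightarrow> bool"
  where "fls_order_ge n z \<longleftrightarrow> (\<forall>m<n. z $$ m = 0)"

lemma fls_order_ge_iff: "fls_order_ge n z \<longleftrightarrow> z = 0 \<or> n \<le> fls_subdegree z"
  unfolding fls_order_ge_def by (auto intro: fls_subdegree_geI)

lemma fls_order_ge_add: "fls_order_ge n y \<Longrightarrow> fls_order_ge n z \<Longrightarrow> fls_order_ge n (y + z)"
  and fls_order_ge_diff: "fls_order_ge n y \<Longrightarrow> fls_order_ge n z \<Longrightarrow> fls_order_ge n (y - z)"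
  by (auto simp: fls_order_ge_def)

lemma fls_order_ge_sum: "(\<And>x. x \<in> S \<Longrightarrow> fls_order_ge n (F x)) \<Longrightarrow> fls_order_ge n (\<Sum>x\<in>S. F x)"
  by (induction S rule: infinite_finite_induct) (auto simp: fls_order_ge_add fls_order_ge_def)

lemma fls_order_ge_mult:
  "fls_order_ge m y \<Longrightarrow> fls_order_ge n z \<Longrightarrow> fls_order_ge (m + n) (y * z)"
  by (cases "y = 0 \<or> z = 0") (auto simp: fls_order_ge_iff)

lemma fls_order_ge_mono: "fls_order_ge m z \<Longrightarrow> n \<le> m \<Longrightarrow> fls_order_ge n z"
  by (auto simp: fls_order_ge_def)

lemma fls_order_ge_all_imp_zero: "(\<And>n::nat. fls_order_ge (int n) z) \<Longrightarrow> z = 0"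
proof (rule ccontr)
  assume *: "\<And>n::nat. fls_order_ge (int n) z" and "z \<noteq> 0"
  then have "int (nat (fls_subdegree z + 1)) \<le> fls_subdegree z"
    using *[of "nat (fls_subdegree z + 1)"] by (auto simp only: fls_order_ge_iff)
  then show False
    by (simp split: if_splits)
qed

text \<open>Successive approximation: the \<open>e n\<close> supply one series of each order from
  \<open>c\<close> on, so the lowest remaining coefficient can always be cancelled. Convergence is
  expressed only through the orders of the remainders.\<close>

lemma fls_triangular_expansion:
  fixes e :: "nat \<Rightarrow> 'k::field fls"
  assumes e: "\<And>n. e n \<noteq> 0" "\<And>n. fls_subdegree (e n) = c + int n"
    and z: "fls_order_ge c z"
  shows "\<exists>a. \<forall>N. fls_order_ge (c + int N) (z - (\<Sum>n<N. fls_const (a n) * e n))"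
proof -
  \<comment> \<open>\<open>q N r\<close> is the scalar whose multiple of \<open>e N\<close> cancels
    the coefficient of \<open>r\<close> at order \<open>c + N\<close>; \<open>r N\<close> in the
    next line is the remainder after \<open>N\<close> steps.\<close>
  define q where "q = (\<lambda>N r. r $$ (c + int N) / e N $$ (c + int N))"
  define r where "r = rec_nat z (\<lambda>N r. r - fls_const (q N r) * e N)"
  have r_Suc: "r (Suc N) = r N - fls_const (q N (r N)) * e N" for N
    by (simp add: r_def)
  have r: "r N = z - (\<Sum>n<N. fls_const (q n (r n)) * e n)" for N
    by (induction N) (simp add: r_def, simp add: r_Suc)
  have "fls_order_ge (c + int N) (r N)" for N
  proof (induction N)
    case 0
    then show ?case
      using z by (simp add: r_def)
  next
    case (Suc N)
    have nz: "e N $$ (c + int N) \<noteq> 0"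
      using e[of N] nth_fls_subdegree_nonzero[of "e N"] by simp
    have "r (Suc N) $$ m = 0" if "m < c + int (Suc N)" for m
    proof (cases "m = c + int N")
      case True
      then show ?thesis
        using nz by (simp add: r_Suc q_def)
    next
      case False
      then have "m < c + int N"
        using that by simp
      then show ?thesis
        using Suc e(2)[of N] by (simp add: r_Suc fls_order_ge_def)
    qed
    then show ?case
      by (simp add: fls_order_ge_def)
  qed
  then have "fls_order_ge (c + int N) (z - (\<Sum>n<N. fls_const (q n (r n)) * e n))" for N
    by (simp flip: r)
  then show ?thesis
    by (intro exI[of _ "\<lambda>n. q n (r n)"] allI)
qed

subsection \<open>Power series and continuity of their homomorphisms\<close>

text \<open>The ideal \<open>\<mm>\<^sup>N\<close>, described by the vanishing of the coefficients of total degree below \<open>N\<close>.\<close>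

definition mps_order_ge :: "nat \<Rightarrow> (('n::finite \<Rightarrow> nat) \<Rightarrow> 'k::field) \<Rightarrow> bool"
  where "mps_order_ge N f \<longleftrightarrow> (\<forall>e. sum e UNIV < N \<longrightarrow> f e = 0)"

lemma mps_order_ge_mult:
  assumes "mps_order_ge p f" "mps_order_ge q g"
  shows "mps_order_ge (p + q) (mps_mult f g)"
  unfolding mps_order_ge_def mps_mult_def
proof (intro allI impI sum.neutral ballI)
  fix e a :: "'a \<Rightarrow> nat"
  assume e: "sum e UNIV < p + q" and a: "a \<in> {..e}"
  \<comment> \<open>By \<open>a \<le> e\<close> the truncated subtraction is exact, so the total
    degrees of the two factors add up to that of \<open>e\<close>.\<close>
  have "sum a UNIV + (\<Sum>i\<in>UNIV. e i - a i) = sum e UNIV"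
    using a by (subst sum.distrib[symmetric]) (auto simp: le_fun_def intro!: sum.cong)
  then have "sum a UNIV < p \<or> (\<Sum>i\<in>UNIV. e i - a i) < q"
    using e by linarith
  then show "f a * g (\<lambda>i. e i - a i) = 0"
    using assms by (auto simp: mps_order_ge_def)
qed

definition mps_var :: "'n::finite \<Rightarrow> ('n \<Rightarrow> nat) \<Rightarrow> 'k::field"
  where "mps_var i = (\<lambda>e. if e = (\<lambda>_. 0)(i := 1) then 1 else 0)"

lemma mps_mult_var:
  "mps_mult (mps_var i) f e = (if e i = 0 then 0 else f (e(i := e i - 1)))"
proof -
  let ?d = "(\<lambda>_. 0)(i := 1 :: nat)"
  have "mps_mult (mps_var i) f e = (\<Sum>a\<in>{..e}. if a = ?d then f (\<lambda>j. e j - ?d j) else 0)"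
    unfolding mps_mult_def mps_var_def by (intro sum.cong) auto
  also have "\<dots> = (if ?d \<in> {..e} then f (\<lambda>j. e j - ?d j) else 0)"
    by (subst sum.delta) (auto simp: finite_atMost_exponent)
  also have "?d \<in> {..e} \<longleftrightarrow> e i \<noteq> 0"
    by (auto simp: le_fun_def)
  also have "(\<lambda>j. e j - ?d j) = e(i := e i - 1)"
    by auto
  finally show ?thesis
    by simp
qed

lemma mps_mult_const: "mps_mult (mps_const c) f = (\<lambda>e. c * f e)"
proof
  fix e
  have "mps_mult (mps_const c) f e = (\<Sum>a\<in>{..e}. if a = (\<lambda>_. 0) then c * f e else 0)"
    unfolding mps_mult_def mps_const_def by (intro sum.cong) auto
  also have "\<dots> = c * f e"
    by (subst sum.delta) (auto simp: finite_atMost_exponent le_fun_def)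
  finally show "mps_mult (mps_const c) f e = c * f e" .
qed

lemma mps_mult_add_left: "mps_mult (f + g) h = mps_mult f h + mps_mult g h"
  by (auto simp: mps_mult_def distrib_right sum.distrib)

text \<open>The inverse is a geometric series: \<open>1 / (X_i - c)\<close> is minus the sum of all
  \<open>X_i^m / c^(m+1)\<close>.\<close>

lemma mps_var_minus_const_unit:
  fixes c :: "'k::field" and i :: "'n::finite"
  assumes "c \<noteq> 0"
  shows "\<exists>h. mps_mult (mps_var i + mps_const (- c)) h = mps_const 1"
proof -
  define h where "h = (\<lambda>e :: 'n \<Rightarrow> nat.
    if \<forall>j. j \<noteq> i \<longrightarrow> e j = 0 then - (inverse c ^ Suc (e i)) else 0)"
  have "mps_mult (mps_var i + mps_const (- c)) h e = mps_const 1 e" for e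
  proof (cases "\<forall>j. j \<noteq> i \<longrightarrow> e j = 0")
    case True
    have 0: "e = (\<lambda>_. 0) \<longleftrightarrow> e i = 0"
      using True by (metis ext)
    have s: "h e = - (inverse c ^ Suc (e i))"
      using True by (simp add: h_def)
    have t: "(if e i = 0 then 0 else h (e(i := e i - 1))) =
        (if e i = 0 then 0 else - (inverse c ^ e i))"
      using True by (simp add: h_def)
    show ?thesis
      using assms
      unfolding mps_mult_add_left mps_mult_const plus_fun_apply mps_mult_var s t
      by (simp add: mps_const_def 0)
  next
    case False
    then have "e \<noteq> (\<lambda>_. 0)"
      by auto
    moreover have "h e = 0" "h (e(i := e i - 1)) = 0"
      using False unfolding h_def by auto
    ultimately show ?thesis
      by (simp add: mps_mult_add_left mps_mult_const mps_mult_var) (simp add: mps_const_def)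
  qed
  then show ?thesis
    by blast
qed

text \<open>Every monomial of positive degree is divisible by some variable. Choosing one,
  \<open>p e\<close>, for each exponent assigns every coefficient of \<open>f\<close> to exactly one
  summand.\<close>

lemma mps_order_ge_Suc_decompose:
  fixes f :: "('n::finite \<Rightarrow> nat) \<Rightarrow> 'k::field"
  assumes f: "mps_order_ge (Suc N) f"
  shows "\<exists>F. (\<forall>i. mps_order_ge N (F i)) \<and> f = (\<Sum>i\<in>UNIV. mps_mult (mps_var i) (F i))"
proof -
  define p where "p = (\<lambda>e :: 'n \<Rightarrow> nat. SOME i. e i \<noteq> 0)"
  \<comment> \<open>\<open>F i\<close> is the part of \<open>f\<close> assigned to the variable
    \<open>i\<close>, divided by that variable.\<close>
  define F where "F = (\<lambda>i (e :: 'n \<Rightarrow> nat).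
    if p (e(i := Suc (e i))) = i then f (e(i := Suc (e i))) else 0)"
  have "mps_order_ge N (F i)" for i
    unfolding mps_order_ge_def
  proof (intro allI impI)
    fix e :: "'n \<Rightarrow> nat"
    assume "sum e UNIV < N"
    moreover have "sum (e(i := Suc (e i))) UNIV = Suc (sum e UNIV)"
      by (simp add: sum.remove[of UNIV i])
    ultimately show "F i e = 0"
      using f by (simp add: F_def mps_order_ge_def del: fun_upd_apply)
  qed
  moreover have "f e = (\<Sum>i\<in>UNIV. mps_mult (mps_var i) (F i)) e" for e
  proof -
    have "(\<Sum>i\<in>UNIV. mps_mult (mps_var i) (F i)) e = (\<Sum>i\<in>UNIV. mps_mult (mps_var i) (F i) e)"
      by (rule sum_fun_apply)
    also have "\<dots> = (\<Sum>i\<in>UNIV. if i = p e then f e else 0)"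
    proof (cases "e = (\<lambda>_. 0)")
      case True
      then have "f e = 0"
        using f by (simp add: mps_order_ge_def)
      then show ?thesis
        using True by (simp add: mps_mult_var)
    next
      case False
      then have "e (p e) \<noteq> 0"
        unfolding p_def by (metis (mono_tags) someI ext)
      then have "mps_mult (mps_var i) (F i) e = (if i = p e then f e else 0)" for i
        by (auto simp: mps_mult_var F_def)
      then show ?thesis
        by simp
    qed
    also have "\<dots> = f e"
      by simp
    finally show ?thesis
      by simp
  qed
  ultimately show ?thesis
    by (intro exI[of _ F]) auto
qed

text \<open>Models the composite of \<open>K[[X_1,...,X_n]]\<close> with one branch.
  \<open>range_integral\<close> places the image in \<open>K[[t]]\<close>, and
  \<open>range_generates\<close> is what is kept of the fraction field being \<open>K((t))\<close>.
  Continuity is derived, not assumed.\<close>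

locale power_series_hom =
  fixes \<psi> :: "(('n::finite \<Rightarrow> nat) \<Rightarrow> 'k::field) \<Rightarrow> 'k fls"
  assumes hom_add: "\<psi> (f + g) = \<psi> f + \<psi> g"
    and hom_mult: "\<psi> (mps_mult f g) = \<psi> f * \<psi> g"
    and hom_const: "\<psi> (mps_const c) = fls_const c"
    and range_integral: "fls_order_ge 0 (\<psi> f)"
    and range_generates: "\<exists>f g. \<psi> g \<noteq> 0 \<and> fls_X = \<psi> f / \<psi> g"
begin

lemma hom_zero: "\<psi> 0 = 0"
  using hom_add[of 0 0] by (metis add_cancel_right_right add_0)

lemma hom_sum: "\<psi> (\<Sum>x\<in>S. F x) = (\<Sum>x\<in>S. \<psi> (F x))"
proof (induction S rule: infinite_finite_induct)
  case (insert x S)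
  then show ?case
    by (simp only: sum.insert hom_add simp_thms)
qed (simp_all only: sum.infinite sum.empty hom_zero simp_thms)

lemma hom_diff: "\<psi> (f - g) = \<psi> f - \<psi> g"
  using hom_add[of "f - g" g] by simp

lemma hom_scale: "\<psi> (\<lambda>e. c * f e) = fls_const c * \<psi> f"
  using hom_mult[of "mps_const c" f] by (simp add: mps_mult_const hom_const)

text \<open>A nonzero constant term \<open>c\<close> of \<open>\<psi> X\<^sub>i\<close> would make the image of the unit \<open>X\<^sub>i - c\<close> a nonunit.\<close>

lemma order_var: "fls_order_ge 1 (\<psi> (mps_var i))"
proof -
  define c where "c = \<psi> (mps_var i) $$ 0"
  have 1: "fls_order_ge 1 (\<psi> (mps_var i + mps_const (- c)))"
    using range_integral[of "mps_var i"]
    by (auto simp: fls_order_ge_def hom_add hom_const c_def)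
  have "c = 0"
  proof (rule ccontr)
    assume "c \<noteq> 0"
    then obtain h where "mps_mult (mps_var i + mps_const (- c)) h = mps_const 1"
      using mps_var_minus_const_unit by blast
    then have "\<psi> (mps_var i + mps_const (- c)) * \<psi> h = 1"
      using hom_const[of 1] by (simp flip: hom_mult)
    moreover have "fls_order_ge (1 + 0) (\<psi> (mps_var i + mps_const (- c)) * \<psi> h)"
      by (intro fls_order_ge_mult 1 range_integral)
    ultimately show False
      by (auto simp: fls_order_ge_def dest!: spec[of _ 0])
  qed
  then show ?thesis
    using 1 by (simp add: hom_add hom_const)
qed

text \<open>Continuity is automatic: each variable split off by
  \<open>mps_order_ge_Suc_decompose\<close> contributes order at least 1, by
  \<open>order_var\<close>.\<close>

lemma hom_continuous: "mps_order_ge N f \<Longrightarrow> fls_order_ge (int N) (\<psi> f)"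
proof (induction N arbitrary: f)
  case 0
  then show ?case
    using range_integral by simp
next
  case (Suc N)
  then obtain F where F: "\<And>i. mps_order_ge N (F i)"
    "f = (\<Sum>i\<in>UNIV. mps_mult (mps_var i) (F i))"
    using mps_order_ge_Suc_decompose by blast
  have "fls_order_ge (1 + int N) (\<psi> (mps_var i) * \<psi> (F i))" for i
    by (intro fls_order_ge_mult order_var Suc.IH F)
  then show ?case
    by (simp add: F(2) hom_sum hom_mult fls_order_ge_sum)
qed

text \<open>The map \<psi> preserves constant terms, because \<open>f\<close> minus its constant
  term has an image of order at least 1.\<close>

lemma mps_order_ge_one:
  assumes "fls_order_ge 1 (\<psi> f)"
  shows "mps_order_ge 1 f"
proof -
  have zero: "e = (\<lambda>_. 0)" if "sum e UNIV < 1" for e :: "'n \<Rightarrow> nat"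
    using that by auto
  have "mps_order_ge 1 (f - mps_const (f (\<lambda>_. 0)))"
    by (auto simp: mps_order_ge_def mps_const_def dest!: zero)
  then have "fls_order_ge 1 (\<psi> (f - mps_const (f (\<lambda>_. 0))))"
    using hom_continuous by fastforce
  then have "f (\<lambda>_. 0) = 0"
    using assms by (auto simp: fls_order_ge_def hom_diff hom_const dest!: spec[of _ 0])
  then show ?thesis
    unfolding mps_order_ge_def
  proof (intro allI impI)
    fix e :: "'n \<Rightarrow> nat"
    assume "sum e UNIV < 1"
    then show "f e = 0"
      using zero[of e] \<open>f (\<lambda>_. 0) = 0\<close> by (simp only:)
  qed
qed

text \<open>Writing \<open>t\<close> as a quotient gives orders \<open>d + 1\<close> and
  \<open>d\<close>, where \<open>d\<close> may be 0. Multiplying both elements by the one of order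
  \<open>d + 1\<close> keeps the difference and makes both orders positive.\<close>

lemma ex_consecutive_orders:
  "\<exists>f g. \<psi> f \<noteq> 0 \<and> \<psi> g \<noteq> 0 \<and> fls_subdegree (\<psi> g) \<ge> 1 \<and>
    fls_subdegree (\<psi> f) = fls_subdegree (\<psi> g) + 1"
proof -
  obtain f g where fg: "\<psi> g \<noteq> 0" "fls_X = \<psi> f / \<psi> g"
    using range_generates by blast
  then have f: "\<psi> f = fls_X * \<psi> g"
    by (simp add: field_simps)
  then have f0: "\<psi> f \<noteq> 0" and deg: "fls_subdegree (\<psi> f) = fls_subdegree (\<psi> g) + 1"
    using fg(1) by (simp_all add: fls_subdegree_mult)
  have g0: "fls_subdegree (\<psi> g) \<ge> 0"
    using range_integral[of g] fg(1) by (simp add: fls_order_ge_iff)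
  show ?thesis
  proof (intro exI conjI)
    show "\<psi> (mps_mult f f) \<noteq> 0" "\<psi> (mps_mult f g) \<noteq> 0"
      using fg(1) f0 by (simp_all add: hom_mult)
    show "fls_subdegree (\<psi> (mps_mult f g)) \<ge> 1"
      "fls_subdegree (\<psi> (mps_mult f f)) = fls_subdegree (\<psi> (mps_mult f g)) + 1"
      using fg(1) f0 deg g0 by (simp_all add: hom_mult)
  qed
qed

text \<open>The power is taken on the side of Laurent series, since \<open>^\<close> on coefficient
  functions is pointwise and differs from iterated \<open>mps_mult\<close>.\<close>

lemma ex_power:
  assumes "mps_order_ge 1 f"
  shows "\<exists>p. \<psi> p = \<psi> f ^ m \<and> mps_order_ge m p"
proof (induction m)
  case 0
  have "\<psi> (mps_const 1) = \<psi> f ^ 0 \<and> mps_order_ge 0 (mps_const 1 :: ('n \<Rightarrow> nat) \<Rightarrow> 'k)"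
    by (simp add: hom_const mps_order_ge_def)
  then show ?case
    by blast
next
  case (Suc m)
  then obtain p where "\<psi> p = \<psi> f ^ m" "mps_order_ge m p"
    by blast
  then have "\<psi> (mps_mult f p) = \<psi> f ^ Suc m \<and> mps_order_ge (1 + m) (mps_mult f p)"
    using mps_order_ge_mult[OF assms] by (simp add: hom_mult)
  then show ?case
    by auto
qed

text \<open>Let \<open>g\<close> and \<open>f\<close> have orders \<beta> and
  \<open>\<beta> + 1\<close>, and let \<open>n = \<beta> * q + r\<close> with
  \<open>r < \<beta>\<close>. Then \<open>f^r * g^(q - r)\<close> has order \<open>n\<close>. As a
  product of \<open>q\<close> nonunits it also lies deep in the power series ring, which later makes
  infinite combinations converge.\<close>

lemma ex_all_large_orders:
  "\<exists>\<beta>::nat. \<beta> \<ge> 1 \<and> (\<forall>n\<ge>\<beta> * \<beta>. \<exists>s. \<psi> s \<noteq> 0 \<and> fls_subdegree (\<psi> s) = int n \<and>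
    mps_order_ge (n div \<beta>) s)"
proof -
  obtain f g where fg: "\<psi> f \<noteq> 0" "\<psi> g \<noteq> 0" "fls_subdegree (\<psi> g) \<ge> 1"
    "fls_subdegree (\<psi> f) = fls_subdegree (\<psi> g) + 1"
    using ex_consecutive_orders by blast
  define \<beta> where "\<beta> = nat (fls_subdegree (\<psi> g))"
  have \<beta>: "\<beta> \<ge> 1" "fls_subdegree (\<psi> g) = int \<beta>"
    using fg(3) by (simp_all add: \<beta>_def)
  have f1: "mps_order_ge 1 f" and g1: "mps_order_ge 1 g"
    using fg by (intro mps_order_ge_one; simp add: fls_order_ge_iff)+
  have "\<exists>s. \<psi> s \<noteq> 0 \<and> fls_subdegree (\<psi> s) = int n \<and> mps_order_ge (n div \<beta>) s"
    if n: "n \<ge> \<beta> * \<beta>" for n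
  proof -
    define q r where "q = n div \<beta>" and "r = n mod \<beta>"
    \<comment> \<open>The bound \<open>\<beta> * \<beta>\<close> forces
      \<open>r < \<beta> \<le> q\<close>, so the exponent \<open>q - r\<close> is not
      truncated.\<close>
    have "\<beta> \<le> q"
      using n \<beta>(1) div_le_mono[of "\<beta> * \<beta>" n \<beta>] by (simp add: q_def)
    moreover have "r < \<beta>"
      using \<beta>(1) by (simp add: r_def)
    ultimately have rq: "r \<le> q"
      by simp
    have n_eq: "n = \<beta> * q + r"
      by (simp add: q_def r_def)
    obtain u v where u: "\<psi> u = \<psi> f ^ r" "mps_order_ge r u"
      and v: "\<psi> v = \<psi> g ^ (q - r)" "mps_order_ge (q - r) v"
      using ex_power[OF f1] ex_power[OF g1] by meson
    have uv: "\<psi> (mps_mult u v) = \<psi> f ^ r * \<psi> g ^ (q - r)"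
      by (simp add: hom_mult u v)
    have "fls_subdegree (\<psi> (mps_mult u v)) = int r * (int \<beta> + 1) + int (q - r) * int \<beta>"
      unfolding uv using fg \<beta> by (simp add: fls_subdegree_pow)
    also have "\<dots> = int n"
      using rq by (simp add: n_eq algebra_simps of_nat_diff)
    finally show ?thesis
      using mps_order_ge_mult[OF u(2) v(2)] rq uv fg(1,2)
      by (intro exI[of _ "mps_mult u v"]) (simp add: q_def)
  qed
  then show ?thesis
    using \<beta>(1) by blast
qed

text \<open>A series of large order is expanded along images of elements \<open>s n\<close>. The
  same infinite combination of the \<open>s n\<close> themselves exists coefficientwise, and
  continuity shows that it maps to the given series.\<close>

lemma range_contains_conductor: "\<exists>c. \<forall>z. fls_order_ge c z \<longrightarrow> z \<in> range \<psi>"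
proof -
  obtain \<beta> :: nat where \<beta>: "\<beta> \<ge> 1"
    and ex: "\<And>n. n \<ge> \<beta> * \<beta> \<Longrightarrow> \<exists>s. \<psi> s \<noteq> 0 \<and> fls_subdegree (\<psi> s) = int n \<and>
      mps_order_ge (n div \<beta>) s"
    using ex_all_large_orders by blast
  define c where "c = \<beta> * \<beta>"
  have "\<forall>n. \<exists>s. \<psi> s \<noteq> 0 \<and> fls_subdegree (\<psi> s) = int (c + n) \<and> mps_order_ge ((c + n) div \<beta>) s"
    using ex unfolding c_def by (metis le_add1)
  then obtain s where s: "\<And>n. \<psi> (s n) \<noteq> 0" "\<And>n. fls_subdegree (\<psi> (s n)) = int c + int n"
    "\<And>n. mps_order_ge ((c + n) div \<beta>) (s n)"
    by (metis of_nat_add)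
  \<comment> \<open>Only finitely many \<open>s n\<close> contribute to a given exponent.\<close>
  have s_vanish: "s n e = 0" if "n \<ge> \<beta> * Suc (sum e UNIV)" for n e
  proof -
    have "Suc (sum e UNIV) \<le> (c + n) div \<beta>"
      using that \<beta> div_le_mono[of "\<beta> * Suc (sum e UNIV)" "c + n" \<beta>] by simp
    then show ?thesis
      using s(3)[of n] by (simp add: mps_order_ge_def)
  qed
  have "z \<in> range \<psi>" if z: "fls_order_ge (int c) z" for z
  proof -
    obtain a where a: "\<And>N. fls_order_ge (int c + int N) (z - (\<Sum>n<N. fls_const (a n) * \<psi> (s n)))"
      using fls_triangular_expansion[of "\<lambda>n. \<psi> (s n)" "int c" z] s z by blast
    \<comment> \<open>This is the infinite sum of all \<open>a n * s n\<close>, cut off at each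
      exponent where its terms have become 0.\<close>
    define F where "F = (\<lambda>e. \<Sum>n<\<beta> * Suc (sum e UNIV). a n * s n e)"
    have "fls_order_ge (int L) (z - \<psi> F)" for L
    proof -
      \<comment> \<open>A partial sum of \<open>\<beta> * L\<close> terms agrees with
        \<open>F\<close> in all total degrees below \<open>L\<close>.\<close>
      define T where "T = (\<Sum>n<\<beta> * L. (\<lambda>e. a n * s n e))"
      have T_apply: "T e = (\<Sum>n<\<beta> * L. a n * s n e)" for e
        unfolding T_def by (rule sum_fun_apply)
      have "mps_order_ge L (F - T)"
        unfolding mps_order_ge_def
      proof (intro allI impI)
        fix e :: "'n \<Rightarrow> nat"
        assume "sum e UNIV < L"
        then have "\<beta> * Suc (sum e UNIV) \<le> \<beta> * L"
          by (intro mult_left_mono) auto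
        then have "T e = F e"
          unfolding T_apply F_def
          by (intro sum.mono_neutral_right) (auto simp: s_vanish)
        then show "(F - T) e = 0"
          by simp
      qed
      then have "fls_order_ge (int L) (\<psi> F - \<psi> T)"
        using hom_continuous by (metis hom_diff)
      moreover have "\<psi> T = (\<Sum>n<\<beta> * L. fls_const (a n) * \<psi> (s n))"
        unfolding T_def by (simp add: hom_sum hom_scale)
      moreover have "int L \<le> int c + int (\<beta> * L)"
        using \<beta> by (metis add_increasing mult_le_mono1 nat_mult_1 of_nat_0_le_iff of_nat_mono)
      ultimately have "fls_order_ge (int L) (\<psi> F - \<psi> T)" "fls_order_ge (int L) (z - \<psi> T)"
        using fls_order_ge_mono[OF a[of "\<beta> * L"]] by simp_all
      \<comment> \<open>Here \<open>z - \<psi> F\<close> is the difference of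
        \<open>z - \<psi> T\<close> and \<open>\<psi> F - \<psi> T\<close>, both of order at least
        \<open>L\<close>.\<close>
      then show ?thesis
        using fls_order_ge_diff[of _ "z - \<psi> T" "\<psi> F - \<psi> T"] by simp
    qed
    then have "z - \<psi> F = 0"
      by (rule fls_order_ge_all_imp_zero)
    then show ?thesis
      by (metis eq_iff_diff_eq_0 rangeI)
  qed
  then show ?thesis
    by blast
qed

end

subsection \<open>The ring of an algebroid curve and its conductor\<close>

text \<open>Collects the properties of the embedded ring on which the argument with values rests.
  The conductor is stated one branch at a time, through elements supported on that branch.\<close>

locale curve_ring =
  fixes \<O> :: "('r::finite \<Rightarrow> 'k::alg_closed_field fls) set"
  assumes const_mem: "(\<lambda>_. fls_const c) \<in> \<O>"
    and add_mem: "f \<in> \<O> \<Longrightarrow> g \<in> \<O> \<Longrightarrow> f + g \<in> \<O>"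
    and mult_mem: "f \<in> \<O> \<Longrightarrow> g \<in> \<O> \<Longrightarrow> f * g \<in> \<O>"
    and conductor: "\<exists>c. \<forall>z. fls_order_ge c z \<longrightarrow> 0(i := z) \<in> \<O>"

section \<open>Cosets of ideals of power series\<close>

lemma mps_coset_eq: "P +>\<^bsub>mps\<^esub> f = {p + f |p. p \<in> P}"
  by (auto simp: a_r_coset_def' mps_def plus_fun_def)

lemma mps_ideal_mem:
  assumes "ideal P mps"
  shows "0 \<in> P" "f \<in> P \<Longrightarrow> g \<in> P \<Longrightarrow> f + g \<in> P" "f \<in> P \<Longrightarrow> - f \<in> P"
proof -
  interpret ideal P mps
    by fact
  show "0 \<in> P"
    using additive_subgroup.zero_closed[OF is_additive_subgroup]
    by (simp add: mps_def zero_fun_def)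
  show "f \<in> P \<Longrightarrow> g \<in> P \<Longrightarrow> f + g \<in> P"
    using additive_subgroup.a_closed[OF is_additive_subgroup]
    by (simp add: mps_def plus_fun_def)
  have "f \<oplus>\<^bsub>mps\<^esub> (\<ominus>\<^bsub>mps\<^esub> f) = \<zero>\<^bsub>mps\<^esub>"
    by (rule r_neg) (simp add: mps_def)
  then have "\<ominus>\<^bsub>mps\<^esub> f = - f"
    by (auto simp: mps_def fun_eq_iff add_eq_0_iff)
  then show "f \<in> P \<Longrightarrow> - f \<in> P"
    using additive_subgroup.a_inv_closed[OF is_additive_subgroup] by metis
qed

lemma mps_coset_eq_iff:
  assumes "ideal P mps"
  shows "P +>\<^bsub>mps\<^esub> f = P +>\<^bsub>mps\<^esub> g \<longleftrightarrow> f - g \<in> P"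
proof
  assume eq: "P +>\<^bsub>mps\<^esub> f = P +>\<^bsub>mps\<^esub> g"
  have "0 + f \<in> P +>\<^bsub>mps\<^esub> f"
    unfolding mps_coset_eq using mps_ideal_mem(1)[OF assms] by blast
  then obtain p where "p \<in> P" "f = p + g"
    unfolding eq unfolding mps_coset_eq by auto
  then show "f - g \<in> P"
    by simp
next
  assume fg: "f - g \<in> P"
  have "p + f = (p + (f - g)) + g" "p + g = (p + - (f - g)) + f" for p
    by (simp_all add: algebra_simps)
  then show "P +>\<^bsub>mps\<^esub> f = P +>\<^bsub>mps\<^esub> g"
    unfolding mps_coset_eq using mps_ideal_mem(2,3)[OF assms] fg
    by (intro equalityI subsetI; clarify; metis)
qed

text \<open>Adding \<open>Q\<close> is absorbed by the larger ideal \<open>P\<close>; this evaluates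
  \<open>embed\<close> on representatives.\<close>

lemma mps_add_coset:
  assumes "ideal P mps" "ideal Q mps" "Q \<subseteq> P"
  shows "P <+>\<^bsub>mps\<^esub> (Q +>\<^bsub>mps\<^esub> f) = P +>\<^bsub>mps\<^esub> f"
proof -
  have "P <+>\<^bsub>mps\<^esub> (Q +>\<^bsub>mps\<^esub> f) = {p + (q + f) |p q. p \<in> P \<and> q \<in> Q}"
    by (auto simp: set_add_def' mps_coset_eq) (auto simp: mps_def plus_fun_def)
  also have "\<dots> = {p + f |p. p \<in> P}"
  proof (intro equalityI subsetI; clarify)
    fix p q
    assume "p \<in> P" "q \<in> Q"
    then have "p + q \<in> P"
      using assms by (auto intro: mps_ideal_mem)
    then show "\<exists>p'. p + (q + f) = p' + f \<and> p' \<in> P"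
      by (metis add.assoc)
  next
    fix p
    assume "p \<in> P"
    then show "\<exists>p' q. p + f = p' + (q + f) \<and> p' \<in> P \<and> q \<in> Q"
      using mps_ideal_mem(1)[OF assms(2)] by (intro exI[of _ p] exI[of _ 0]) simp
  qed
  finally show ?thesis
    by (simp add: mps_coset_eq)
qed

lemma carrier_mps_Quot: "carrier (mps Quot P) = range (\<lambda>f. P +>\<^bsub>mps\<^esub> f)"
  by (auto simp: FactRing_def A_RCOSETS_def') (auto simp: mps_def)

text \<open>The kernel is \<open>P\<close> because \<phi> is injective on the quotient. The image
  consists of integral elements, so it lies in \<open>K[[t]]\<close>, and the fraction field clause
  applied to \<open>t\<close> gives the last locale assumption.\<close>

lemma power_series_hom_normalization:
  fixes P :: "(('n::finite \<Rightarrow> nat) \<Rightarrow> 'k::field) set"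
  assumes P: "ideal P mps" and \<phi>: "normalization P \<phi>"
  shows "power_series_hom (\<lambda>f. \<phi> (P +>\<^bsub>mps\<^esub> f))"
    and "\<phi> (P +>\<^bsub>mps\<^esub> f) = 0 \<longleftrightarrow> f \<in> P"
proof -
  interpret P: ideal P mps
    by fact
  define \<psi> where "\<psi> = (\<lambda>f. \<phi> (P +>\<^bsub>mps\<^esub> f))"
  define A where "A = \<phi> ` carrier (mps Quot P)"
  have A: "A = range \<psi>"
    by (auto simp: A_def \<psi>_def carrier_mps_Quot)
  have \<phi>_hom: "\<phi> \<in> ring_hom (mps Quot P) fls_ring"
    and \<phi>_inj: "inj_on \<phi> (carrier (mps Quot P))"
    and \<phi>_const: "\<And>c. \<psi> (mps_const c) = fls_const c"
    and \<phi>_quot: "\<And>z. \<exists>a\<in>A. \<exists>b\<in>A. b \<noteq> 0 \<and> z = a / b"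
    and \<phi>_int: "integral_closure A = range fps_to_fls"
    using \<phi> unfolding normalization_def Let_def A_def \<psi>_def by blast+
  have \<psi>_hom: "\<psi> \<in> ring_hom mps fls_ring"
    using ring_hom_trans[OF P.rcos_ring_hom \<phi>_hom] by (simp add: \<psi>_def comp_def)
  have add: "\<psi> (f + g) = \<psi> f + \<psi> g" for f g
    using ring_hom_add[OF \<psi>_hom, of f g] by (simp add: mps_def fls_ring_def plus_fun_def)
  have mult: "\<psi> (mps_mult f g) = \<psi> f * \<psi> g" for f g
    using ring_hom_mult[OF \<psi>_hom, of f g] by (simp add: mps_def fls_ring_def)
  have zero: "\<psi> 0 = 0"
    using add[of 0 0] by (metis add_cancel_right_right add_0)
  have neg: "\<psi> (- f) = - \<psi> f" for f
    using add[of f "- f"] zero by (metis add.right_inverse add_eq_0_iff)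
  have "\<psi> f = 0 \<longleftrightarrow> P +>\<^bsub>mps\<^esub> f = P +>\<^bsub>mps\<^esub> 0"
    using zero inj_onD[OF \<phi>_inj] unfolding \<psi>_def carrier_mps_Quot by (metis rangeI)
  then show "\<phi> (P +>\<^bsub>mps\<^esub> f) = 0 \<longleftrightarrow> f \<in> P"
    unfolding mps_coset_eq_iff[OF P] \<psi>_def by simp
  have integral: "fls_order_ge 0 (\<psi> f)" for f
  proof -
    \<comment> \<open>The monic linear polynomial with root \<open>\<psi> f\<close> witnesses
      integrality.\<close>
    have "poly.coeff [:- \<psi> f, 1:] i \<in> A" for i
    proof -
      have "\<psi> (mps_const 1) \<in> A" "\<psi> (- f) \<in> A" "\<psi> 0 \<in> A"
        unfolding A by simp_all
      then show ?thesis
        by (simp add: \<phi>_const zero neg coeff_pCons split: nat.splits)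
    qed
    then have "\<psi> f \<in> integral_closure A"
      unfolding integral_closure_def by (auto intro!: exI[of _ "[:- \<psi> f, 1:]"])
    then show ?thesis
      unfolding \<phi>_int by (auto simp: fls_order_ge_iff fls_subdegree_fls_to_fps_gt0)
  qed
  show "power_series_hom (\<lambda>f. \<phi> (P +>\<^bsub>mps\<^esub> f))"
    unfolding \<psi>_def[symmetric]
  proof
    show "\<exists>f g. \<psi> g \<noteq> 0 \<and> fls_X = \<psi> f / \<psi> g"
      using \<phi>_quot[of fls_X] unfolding A by auto
  qed (simp_all only: add mult \<phi>_const integral)
qed

section \<open>The branches and the embedding into the total ring of fractions\<close>

context algebroid_curve
begin

text \<open>Works with power series as representatives instead of cosets of \<open>Q\<close>;
  \<open>embed_image\<close> shows that the range is that of \<open>embed\<close>.\<close>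

definition branch_map :: "(('n \<Rightarrow> nat) \<Rightarrow> 'k) \<Rightarrow> 'r \<Rightarrow> 'k fls"
  where "branch_map f = (\<lambda>i. \<phi> i (P i +>\<^bsub>mps\<^esub> f))"

lemma prime_branch: "primeideal (P i) mps"
  and minimal_branch: "primeideal P' mps \<Longrightarrow> Q \<subseteq> P' \<Longrightarrow> P' \<subseteq> P i \<Longrightarrow> P' = P i"
  using bij_betw_apply[OF branches, of i] by (auto simp: minimal_primes_def)

lemma ideal_branch: "ideal (P i) mps"
  using prime_branch primeideal.axioms(1) by blast

lemma power_series_hom_branch_map: "power_series_hom (\<lambda>f. branch_map f i)"
  and branch_map_eq_0_iff: "branch_map f i = 0 \<longleftrightarrow> f \<in> P i"
  unfolding branch_map_def
  using power_series_hom_normalization[OF ideal_branch branch_normalization] by blast+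

lemma embed_image: "embed P \<phi> ` carrier (mps Quot Q) = range branch_map"
proof -
  have "embed P \<phi> (Q +>\<^bsub>mps\<^esub> f) = branch_map f" for f
  proof
    fix i
    have "ideal Q mps" "Q \<subseteq> P i"
      using radical Int_branches by (auto simp: radical_ideal_def)
    then show "embed P \<phi> (Q +>\<^bsub>mps\<^esub> f) i = branch_map f i"
      by (simp add: embed_def branch_map_def mps_add_coset[OF ideal_branch])
  qed
  then show ?thesis
    unfolding carrier_mps_Quot image_image by simp
qed

text \<open>Distinct minimal primes are incomparable, so for each \<open>j \<noteq> i\<close> some
  element lies in \<open>P j\<close> but not in \<open>P i\<close>. The product of these stays
  nonzero on branch \<open>i\<close>, where values lie in a field.\<close>

lemma ex_vanishing_off_branch: "\<exists>f. branch_map f i \<noteq> 0 \<and> (\<forall>j\<in>S - {i}. branch_map f j = 0)"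
proof (induction S rule: infinite_finite_induct)
  case (infinite S)
  then show ?case
    by simp
next
  case empty
  have "branch_map (mps_const 1) i = fls_const 1"
    using power_series_hom.hom_const[OF power_series_hom_branch_map] .
  then have "branch_map (mps_const 1) i \<noteq> 0"
    by simp
  then show ?case
    by blast
next
  case (insert j S)
  then obtain f where f: "branch_map f i \<noteq> 0" "\<forall>j\<in>S - {i}. branch_map f j = 0"
    by blast
  show ?case
  proof (cases "j = i")
    case True
    then show ?thesis
      using f by (intro exI[of _ f]) auto
  next
    case False
    have "\<not> P j \<subseteq> P i"
    proof
      assume "P j \<subseteq> P i"
      then have "P j = P i"
        using Int_branches by (intro minimal_branch prime_branch) auto
      then show False
        using bij_betw_imp_inj_on[OF branches] False by (auto dest: injD)
    qed
    then obtain g where g: "branch_map g j = 0" "branch_map g i \<noteq> 0"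
      by (auto simp: branch_map_eq_0_iff)
    have "branch_map (mps_mult f g) l = branch_map f l * branch_map g l" for l
      using power_series_hom.hom_mult[OF power_series_hom_branch_map] .
    then show ?thesis
      using f g by (intro exI[of _ "mps_mult f g"]) auto
  qed
qed

lemma curve_ring_embed: "curve_ring (embed P \<phi> ` carrier (mps Quot Q))"
  unfolding embed_image
proof
  interpret B: power_series_hom "\<lambda>f. branch_map f i" for i
    by (rule power_series_hom_branch_map)
  fix f g c i
  have "branch_map (mps_const c) = (\<lambda>_. fls_const c)"
    by (simp add: fun_eq_iff B.hom_const)
  then show "(\<lambda>_. fls_const c) \<in> range branch_map"
    by (metis rangeI)
  have add: "branch_map p + branch_map q = branch_map (p + q)" for p q
    by (rule ext) (simp only: plus_fun_apply B.hom_add)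
  show "f \<in> range branch_map \<Longrightarrow> g \<in> range branch_map \<Longrightarrow> f + g \<in> range branch_map"
    using add by auto
  have mult: "branch_map p * branch_map q = branch_map (mps_mult p q)" for p q
    by (simp add: fun_eq_iff B.hom_mult)
  show "f \<in> range branch_map \<Longrightarrow> g \<in> range branch_map \<Longrightarrow> f * g \<in> range branch_map"
    using mult by auto
  obtain x where x: "branch_map x i \<noteq> 0" "\<And>j. j \<noteq> i \<Longrightarrow> branch_map x j = 0"
    using ex_vanishing_off_branch[of i UNIV] by auto
  obtain d where d: "\<And>z. fls_order_ge d z \<Longrightarrow> z \<in> range (\<lambda>f. branch_map f i)"
    using B.range_contains_conductor by blast
  show "\<exists>c. \<forall>z. fls_order_ge c z \<longrightarrow> 0(i := z) \<in> range branch_map"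
  proof (intro exI allI impI)
    fix z :: "'k fls"
    \<comment> \<open>The bound is shifted by the order of \<open>x\<close> on branch
      \<open>i\<close>, so that the quotient of \<open>z\<close> by this component still lies in the
      conductor of the branch. Multiplying a lift by \<open>x\<close> clears the other
      branches.\<close>
    assume z: "fls_order_ge (d + fls_subdegree (branch_map x i)) z"
    have "fls_order_ge d (z / branch_map x i)"
      using z x(1) by (cases "z = 0") (auto simp: fls_order_ge_iff fls_divide_subdegree)
    then obtain y where "z / branch_map x i = branch_map y i"
      using d by blast
    then have "z = branch_map x i * branch_map y i"
      using x(1) by (simp add: field_simps)
    then have "0(i := z) = branch_map (mps_mult x y)"
      using x(2) by (auto simp: fun_eq_iff B.hom_mult)
    then show "0(i := z) \<in> range branch_map"
      by simp
  qed
qed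

end

subsection \<open>Values\<close>

definition fls_val :: "'k::field fls \<Rightarrow> int extended"
  where "fls_val z = (if z = 0 then Pinf else Fin (fls_subdegree z))"

lemma val_apply: "val h i = fls_val (h i)"
  by (simp add: val_def fls_val_def)

lemma fls_val_mult: "fls_val (y * z) = fls_val y + fls_val z"
  by (auto simp: fls_val_def)

lemma Fin_le_fls_val_iff: "Fin n \<le> fls_val z \<longleftrightarrow> fls_order_ge n z"
  by (auto simp: fls_val_def fls_order_ge_iff)

lemma fls_val_diff_ge:
  assumes "\<nu> \<le> fls_val y" "\<nu> \<le> fls_val z"
  shows "\<nu> \<le> fls_val (y - z)"
proof (cases \<nu>)
  case (Fin n)
  then show ?thesis
    using assms by (simp add: Fin_le_fls_val_iff fls_order_ge_diff)
qed (use assms in \<open>auto simp: fls_val_def split: if_splits\<close>)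

lemma fls_val_diff_eq:
  assumes "fls_val y < fls_val z"
  shows "fls_val (y - z) = fls_val y"
proof -
  have y: "y \<noteq> 0"
    using assms by (auto simp: fls_val_def)
  have z: "z $$ n = 0" if "n \<le> fls_subdegree y" for n
    using that assms y by (cases "z = 0") (auto simp: fls_val_def)
  have nz: "(y - z) $$ fls_subdegree y \<noteq> 0"
    using y z by simp
  then have "fls_subdegree (y - z) = fls_subdegree y"
    using z by (intro fls_subdegree_eqI) simp_all
  moreover have "y - z \<noteq> 0"
    using nz by auto
  ultimately show ?thesis
    using y by (simp add: fls_val_def)
qed

text \<open>At the smaller of the two orders, at most one nonzero scalar can make the coefficients
  cancel.\<close>

lemma fls_val_generic_combination:
  "\<exists>d. \<forall>c. c \<noteq> 0 \<longrightarrow> c \<noteq> d \<longrightarrow> fls_val (y + fls_const c * z) = inf (fls_val y) (fls_val z)"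
proof (cases "y = 0 \<or> z = 0")
  case True
  have "fls_val (fls_const c * z) = fls_val z" if "c \<noteq> 0" for c
    using that by (simp add: fls_val_def)
  then show ?thesis
    using True by (auto simp: fls_val_def)
next
  case False
  define n where "n = min (fls_subdegree y) (fls_subdegree z)"
  have "fls_val (y + fls_const c * z) = inf (fls_val y) (fls_val z)"
    \<comment> \<open>If the orders differ, this quotient is 0, through its numerator or through
      division by zero, and only \<open>c = 0\<close> is excluded.\<close>
    if c: "c \<noteq> 0" "c \<noteq> - (y $$ n) / z $$ n" for c
  proof -
    have nz: "(y + fls_const c * z) $$ n \<noteq> 0"
    proof (cases "fls_subdegree y" "fls_subdegree z" rule: linorder_cases)
      case less
      then show ?thesis
        using False by (simp add: n_def)
    next
      case equal
      then have "z $$ n \<noteq> 0"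
        using False by (simp add: n_def)
      then show ?thesis
        using c by (auto simp: field_simps add_eq_0_iff)
    next
      case greater
      then show ?thesis
        using c False by (simp add: n_def)
    qed
    then have "fls_subdegree (y + fls_const c * z) = n"
      by (intro fls_subdegree_eqI) (simp_all add: n_def)
    moreover have "y + fls_const c * z \<noteq> 0"
      using nz by (metis fls_zero_nth)
    ultimately show ?thesis
      using False by (simp add: fls_val_def n_def inf_min)
  qed
  then show ?thesis
    by blast
qed

lemma val_mult: "val (f * g) = val f + val g"
  by (rule ext) (simp add: val_apply fls_val_mult)

lemma val_zero: "val 0 = (\<lambda>_. Pinf)"
  by (rule ext) (simp add: val_apply fls_val_def)

lemma val_one: "val 1 = 0"
  by (rule ext) (simp add: val_apply fls_val_def zero_extended_def)

text \<open>Each of the finitely many branches excludes at most two scalars, and the field is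
  infinite.\<close>

lemma val_generic_combination:
  fixes f g :: "'r::finite \<Rightarrow> 'k::alg_closed_field fls"
  shows "\<exists>c. val (f + (\<lambda>_. fls_const c) * g) = inf (val f) (val g)"
proof -
  have "\<forall>i. \<exists>d. \<forall>c. c \<noteq> 0 \<longrightarrow> c \<noteq> d \<longrightarrow>
      fls_val (f i + fls_const c * g i) = inf (fls_val (f i)) (fls_val (g i))"
    using fls_val_generic_combination by blast
  then obtain d where d: "\<And>i c. c \<noteq> 0 \<Longrightarrow> c \<noteq> d i \<Longrightarrow>
      fls_val (f i + fls_const c * g i) = inf (fls_val (f i)) (fls_val (g i))"
    by metis
  obtain c where "c \<notin> insert 0 (range d)"
    using ex_new_if_finite[OF infinite_alg_closed_field] by (metis finite finite_imageI finite_insert)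
  then have "val (f + (\<lambda>_. fls_const c) * g) = inf (val f) (val g)"
    by (intro ext) (simp add: val_apply image_iff d)
  then show ?thesis
    by blast
qed

lemma extended_add_inf_distrib: "a + inf b c = inf (a + b) (a + c)" for a b c :: "int extended"
  by (cases a; cases b; cases c) (simp_all add: inf_min min_add_distrib_right)

lemma extended_fun_add_inf_distrib:
  fixes a b c :: "'r \<Rightarrow> int extended"
  shows "a + inf b c = inf (a + b) (a + c)" "inf b c + a = inf (b + a) (c + a)"
proof -
  show *: "a + inf b c = inf (a + b) (a + c)"
    by (rule ext) (simp add: extended_add_inf_distrib)
  show "inf b c + a = inf (b + a) (c + a)"
    using * by (simp only: add.commute)
qed

lemma inf_Pinf: "inf (\<lambda>_. Pinf) a = a" "inf a (\<lambda>_. Pinf) = a" for a :: "'r \<Rightarrow> int extended"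
  by (intro inf_absorb2 inf_absorb1; simp add: le_fun_def)+

lemma Pinf_add: "(\<lambda>_. Pinf) + a = (\<lambda>_. Pinf)" "a + (\<lambda>_. Pinf) = (\<lambda>_. Pinf)"
  for a :: "'r \<Rightarrow> int extended"
proof -
  have "Pinf + x = Pinf" "x + Pinf = Pinf" for x :: "int extended"
    by (cases x; simp)+
  then show "(\<lambda>_. Pinf) + a = (\<lambda>_. Pinf)" "a + (\<lambda>_. Pinf) = (\<lambda>_. Pinf)"
    by (simp_all add: fun_eq_iff)
qed

lemma Inf_fin_mem:
  assumes "finite S" "S \<noteq> {}" "S \<subseteq> T" "\<And>x y. x \<in> T \<Longrightarrow> y \<in> T \<Longrightarrow> inf x y \<in> T"
  shows "Inf_fin S \<in> T"
  using assms(1-3) by (induction S rule: finite_ne_induct) (simp_all add: assms(4))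

lemma abelian_monoid_value_semimodule:
  assumes "(\<lambda>_. Pinf) \<in> \<Lambda>" "\<And>x y. x \<in> \<Lambda> \<Longrightarrow> y \<in> \<Lambda> \<Longrightarrow> inf x y \<in> \<Lambda>"
  shows "abelian_monoid (value_semimodule \<Lambda>)"
  by (rule abelian_monoidI)
    (simp_all add: value_semimodule_def assms inf_Pinf inf_assoc inf_commute inf_left_commute)

text \<open>Over a nonempty index set the neutral \<open>Pinf\<close> is absorbed.
  \<open>Inf_fin\<close> ranges over the image of \<open>F\<close>, so equal values collapse; this
  is harmless because \<open>inf\<close> is idempotent.\<close>

lemma finsum_value_semimodule:
  assumes \<Lambda>: "abelian_monoid (value_semimodule \<Lambda>)"
    and "finite A" "A \<noteq> {}" "F \<in> A \<rightarrow> \<Lambda>"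
  shows "finsum (value_semimodule \<Lambda>) F A = Inf_fin (F ` A)"
proof -
  interpret abelian_monoid "value_semimodule \<Lambda>"
    by fact
  have simps: "carrier (value_semimodule \<Lambda>) = \<Lambda>" "\<zero>\<^bsub>value_semimodule \<Lambda>\<^esub> = (\<lambda>_. Pinf)"
    "x \<oplus>\<^bsub>value_semimodule \<Lambda>\<^esub> y = inf x y" for x y
    by (simp_all add: value_semimodule_def)
  show ?thesis
    using assms(2-4)
  proof (induction A rule: finite_ne_induct)
    case (singleton x)
    then have "finsum (value_semimodule \<Lambda>) F (insert x {}) = F x"
      by (subst finsum_insert) (simp_all add: simps inf_Pinf)
    then show ?case
      by simp
  next
    case (insert x A)
    then have "finsum (value_semimodule \<Lambda>) F (insert x A) = inf (F x) (Inf_fin (F ` A))"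
      by (subst finsum_insert) (simp_all add: simps Pi_iff)
    then show ?case
      using insert by simp
  qed
qed

subsection \<open>Modules over the ring of a curve\<close>

text \<open>Covers both fractional ideals and the ring itself, so that closure of values under
  infima is proved once for both.\<close>

locale curve_module = curve_ring \<O> for \<O> :: "('r::finite \<Rightarrow> 'k::alg_closed_field fls) set" +
  fixes \<I> :: "('r \<Rightarrow> 'k fls) set"
  assumes zero_mem_module: "0 \<in> \<I>"
    and add_mem_module: "f \<in> \<I> \<Longrightarrow> g \<in> \<I> \<Longrightarrow> f + g \<in> \<I>"
    and smult_mem_module: "a \<in> \<O> \<Longrightarrow> f \<in> \<I> \<Longrightarrow> a * f \<in> \<I>"
    and conductor_module: "\<exists>c. \<forall>z. fls_order_ge c z \<longrightarrow> 0(i := z) \<in> \<I>"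
begin

lemma diff_mem_module:
  assumes "f \<in> \<I>" "g \<in> \<I>"
  shows "f - g \<in> \<I>"
proof -
  have "f + (\<lambda>_. fls_const (- 1)) * g \<in> \<I>"
    using assms by (intro add_mem_module smult_mem_module const_mem)
  also have "f + (\<lambda>_. fls_const (- 1)) * g = f - g"
    by (intro ext fls_eqI) simp
  finally show ?thesis .
qed

lemma Pinf_mem_val: "(\<lambda>_. Pinf) \<in> val ` \<I>"
  using imageI[OF zero_mem_module, of val] by (simp only: val_zero)

lemma inf_mem_val:
  assumes "x \<in> val ` \<I>" "y \<in> val ` \<I>"
  shows "inf x y \<in> val ` \<I>"
proof -
  obtain f g where fg: "f \<in> \<I>" "g \<in> \<I>" "x = val f" "y = val g"
    using assms by blast
  obtain c where "val (f + (\<lambda>_. fls_const c) * g) = inf x y"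
    using val_generic_combination fg by blast
  moreover have "f + (\<lambda>_. fls_const c) * g \<in> \<I>"
    using fg by (intro add_mem_module smult_mem_module const_mem)
  ultimately show ?thesis
    by (auto intro: rev_image_eqI)
qed

lemma add_mem_val: "x \<in> val ` \<O> \<Longrightarrow> y \<in> val ` \<I> \<Longrightarrow> x + y \<in> val ` \<I>"
  using smult_mem_module val_mult by (metis (no_types, lifting) imageE imageI)

text \<open>The induction measures, on the branches other than \<open>k\<close>, how far the orders
  of \<open>f\<close> lie below the conductor bounds.\<close>

lemma ex_module_value_attaining:
  assumes H: "H \<subseteq> \<I>"
    and red: "\<And>f. f \<in> \<I> \<Longrightarrow> f \<noteq> 0 \<Longrightarrow>
      \<exists>j. \<exists>a\<in>\<O>. \<exists>h\<in>H. val f \<le> val (f - a * h) \<and> val f j < val (f - a * h) j"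
    and f: "f \<in> \<I>" "f k \<noteq> 0"
  shows "\<exists>a\<in>\<O>. \<exists>h\<in>H. val f \<le> val a + val h \<and> (val a + val h) k = val f k"
proof -
  obtain c where c: "\<And>i z. fls_order_ge (c i) z \<Longrightarrow> 0(i := z) \<in> \<I>"
    using choice[of "\<lambda>i c. \<forall>z. fls_order_ge c z \<longrightarrow> 0(i := z) \<in> \<I>"] conductor_module by blast
  \<comment> \<open>The \<open>Suc\<close> makes every nonzero component count, even beyond the
    conductor, so that deleting such a component lowers the measure.\<close>
  define w where "w = (\<lambda>(f :: 'r \<Rightarrow> 'k fls) i. if f i = 0 then 0 else Suc (nat (c i - fls_subdegree (f i))))"
  show ?thesis
    using f
  proof (induction "sum (w f) (UNIV - {k})" arbitrary: f rule: less_induct)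
    case less
    show ?case
    proof (cases "\<exists>i. i \<noteq> k \<and> f i \<noteq> 0 \<and> c i \<le> fls_subdegree (f i)")
      case True
      then obtain i where i: "i \<noteq> k" "f i \<noteq> 0" "c i \<le> fls_subdegree (f i)"
        by blast
      define f' where "f' = f(i := 0)"
      have "0(i := f i) \<in> \<I>"
        using i by (intro c) (simp add: fls_order_ge_iff)
      moreover have "f' = f - 0(i := f i)"
        by (rule ext) (simp add: f'_def)
      ultimately have "f' \<in> \<I>"
        using diff_mem_module[OF less.prems(1)] by (simp only:)
      moreover have f'_k: "f' k \<noteq> 0"
        using i less.prems by (simp add: f'_def)
      moreover have "sum (w f') (UNIV - {k}) < sum (w f) (UNIV - {k})"
        using i by (intro sum_strict_mono_ex1) (auto simp: w_def f'_def)
      ultimately obtain a h where ah: "a \<in> \<O>" "h \<in> H" "val f' \<le> val a + val h"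
        "(val a + val h) k = val f' k"
        using less.hyps[of f'] by blast
      \<comment> \<open>Deleting a component raises its value to infinity, so a lower bound by
        \<open>val f'\<close> is also one by \<open>val f\<close>.\<close>
      have "val f \<le> val f'"
        by (auto simp: le_fun_def val_apply f'_def fls_val_def)
      then have "val f \<le> val a + val h"
        using ah(3) by (rule order_trans)
      moreover have "val f' k = val f k"
        using i by (simp add: f'_def val_apply)
      ultimately show ?thesis
        using ah by (intro bexI[of _ a] bexI[of _ h]) simp_all
    next
      case False
      have "f \<noteq> 0"
        using less.prems by auto
      then obtain j a h where ah: "a \<in> \<O>" "h \<in> H" and le: "val f \<le> val (f - a * h)"
        and j: "val f j < val (f - a * h) j"
        using red[OF less.prems(1)] by blast
      define f' where "f' = f - a * h"
      have "f' \<in> \<I>"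
        unfolding f'_def using ah less.prems(1) H by (intro diff_mem_module smult_mem_module) blast+
      have f'_le: "fls_val (f i) \<le> fls_val (f' i)" for i
        using le by (auto simp: f'_def le_fun_def val_apply)
      have j: "fls_val (f j) < fls_val (f' j)"
        using j by (simp add: f'_def val_apply)
      have ah_eq: "a * h = f - f'"
        by (simp add: f'_def)
      show ?thesis
      proof (cases "fls_val (f k) < fls_val (f' k)")
        case True
        have "val f \<le> val (a * h)"
          \<comment> \<open>The subtracted element is \<open>f - f'\<close>, and \<open>f'\<close>
            has no smaller value than \<open>f\<close> on any branch and a strictly larger one at
            \<open>k\<close>.\<close>
          unfolding le_fun_def val_apply ah_eq fun_diff_def by (intro allI fls_val_diff_ge f'_le order_refl)
        moreover have "val (a * h) k = val f k"
          unfolding val_apply ah_eq fun_diff_def by (intro fls_val_diff_eq True)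
        ultimately show ?thesis
          using ah unfolding val_mult by blast
      next
        case False': False
        then have k_eq: "fls_val (f' k) = fls_val (f k)"
          using f'_le[of k] by simp
        then have "f' k \<noteq> 0"
          using less.prems by (auto simp: fls_val_def split: if_splits)
        have "j \<noteq> k"
          using j k_eq by auto
        have "w f' i \<le> w f i" for i
          using f'_le[of i] by (auto simp: w_def fls_val_def split: if_splits)
        moreover have "f j \<noteq> 0"
          using j by (auto simp: fls_val_def)
        \<comment> \<open>All nonzero components of \<open>f\<close> off \<open>k\<close> lie below
          their conductor bounds here, so the truncation by \<open>nat\<close> does not spoil
          strictness.\<close>
        then have "w f' j < w f j"
          using j False \<open>j \<noteq> k\<close> by (auto simp: w_def fls_val_def split: if_splits)
        ultimately have "sum (w f') (UNIV - {k}) < sum (w f) (UNIV - {k})"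
          using \<open>j \<noteq> k\<close> by (intro sum_strict_mono_ex1) auto
        then obtain a' h' where ah': "a' \<in> \<O>" "h' \<in> H" "val f' \<le> val a' + val h'"
          "(val a' + val h') k = val f' k"
          using less.hyps[of f'] \<open>f' \<in> \<I>\<close> \<open>f' k \<noteq> 0\<close> by blast
        have "val f \<le> val f'"
          using f'_le by (simp add: le_fun_def val_apply)
        then have "val f \<le> val a' + val h'"
          using ah'(3) by (rule order_trans)
        moreover have "val f' k = val f k"
          using k_eq by (simp add: val_apply)
        ultimately show ?thesis
          using ah' by (intro bexI[of _ a'] bexI[of _ h']) simp_all
      qed
    qed
  qed
qed

end

sublocale curve_ring \<subseteq> as_module: curve_module \<O> \<O>
proof
  show "0 \<in> \<O>"
    using const_mem[of 0] by (simp add: zero_fun_def)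
qed (auto intro: add_mem mult_mem conductor)

context curve_module
begin

text \<open>Zero and unit are the values of 0 and 1. Closure under \<open>inf\<close> comes from
  generic combinations; the algebraic laws hold branch by branch in
  \<open>int extended\<close>.\<close>

lemma value_semimodule: "semimodule (value_semiring (val ` \<O>)) (value_semimodule (val ` \<I>))"
proof -
  have R: "abelian_monoid (value_semiring (val ` \<O>))"
    by (rule abelian_monoidI)
      (simp_all add: value_semiring_def inf_Pinf inf_assoc inf_commute inf_left_commute
        as_module.Pinf_mem_val as_module.inf_mem_val)
  have R': "comm_monoid (value_semiring (val ` \<O>))"
  proof (rule comm_monoidI)
    have "(1 :: 'r \<Rightarrow> 'k fls) \<in> \<O>"
      using const_mem[of 1] by (simp add: one_fun_def)
    then show "\<one>\<^bsub>value_semiring (val ` \<O>)\<^esub> \<in> carrier (value_semiring (val ` \<O>))"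
      using val_one by (auto simp: value_semiring_def intro: rev_image_eqI)
  qed (simp_all add: value_semiring_def as_module.add_mem_val add.assoc add.commute add.left_commute)
  have M: "abelian_monoid (value_semimodule (val ` \<I>))"
    by (intro abelian_monoid_value_semimodule Pinf_mem_val inf_mem_val)
  have "semiring (value_semiring (val ` \<O>))"
  proof (intro semiring.intro semiring_axioms.intro R comm_monoid.axioms(1)[OF R'])
  qed (simp_all add: value_semiring_def extended_fun_add_inf_distrib Pinf_add)
  then show ?thesis
  proof (intro semimodule.intro semimodule_axioms.intro R' M)
  qed (simp_all add: value_semiring_def value_semimodule_def add_mem_val
      extended_fun_add_inf_distrib Pinf_add add.assoc)
qed

text \<open>Each branch \<open>k\<close> supplies a pair \<open>a k\<close>, \<open>h k\<close>
  whose value bounds \<nu> from above and meets it at \<open>k\<close>. Branches with the same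
  generator value are merged by taking the infimum of their coefficients.\<close>

lemma val_generated:
  assumes H: "finite H" "H \<subseteq> \<I>" "H \<noteq> {}"
    and red: "\<And>f. f \<in> \<I> \<Longrightarrow> f \<noteq> 0 \<Longrightarrow>
      \<exists>j. \<exists>a\<in>\<O>. \<exists>h\<in>H. val f \<le> val (f - a * h) \<and> val f j < val (f - a * h) j"
    and \<nu>: "\<nu> \<in> val ` \<I>"
  shows "\<exists>\<gamma>\<in>val ` H \<rightarrow> val ` \<O>. \<nu> = Inf_fin ((\<lambda>\<mu>. \<gamma> \<mu> + \<mu>) ` val ` H)"
proof -
  obtain f where f: "f \<in> \<I>" "\<nu> = val f"
    using \<nu> by blast
  have "\<exists>a\<in>\<O>. \<exists>h\<in>H. \<nu> \<le> val a + val h \<and> (val a + val h) k = \<nu> k" for k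
  proof (cases "f k = 0")
    case True
    \<comment> \<open>On a branch where \<open>f\<close> vanishes, any generator with coefficient 0
      serves.\<close>
    obtain h where "h \<in> H"
      using H by blast
    moreover have "\<nu> k = Pinf"
      using True f by (simp add: val_def)
    ultimately show ?thesis
      using as_module.zero_mem_module
      by (intro bexI[of _ 0] bexI[of _ h]) (simp_all add: val_zero Pinf_add le_fun_def)
  next
    case False
    then show ?thesis
      using ex_module_value_attaining[OF H(2) red f(1)] f(2) by blast
  qed
  then obtain a h where ah: "\<And>k. a k \<in> \<O>" "\<And>k. h k \<in> H" "\<And>k. \<nu> \<le> val (a k) + val (h k)"
    "\<And>k. (val (a k) + val (h k)) k = \<nu> k"
    by metis
  \<comment> \<open>The added \<open>Pinf\<close>, the value of 0, is the coefficient of a generator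
    that no branch selects and is neutral for the others.\<close>
  define S where "S = (\<lambda>\<mu>. insert (\<lambda>_. Pinf) ((\<lambda>k. val (a k)) ` {k. val (h k) = \<mu>}))"
  define \<gamma> where "\<gamma> = (\<lambda>\<mu>. Inf_fin (S \<mu>))"
  have S: "finite (S \<mu>)" "S \<mu> \<noteq> {}" for \<mu>
    by (simp_all add: S_def)
  \<comment> \<open>The set of admissible coefficients is closed under \<open>inf\<close>, since
    addition distributes over it.\<close>
  have \<gamma>: "\<gamma> \<mu> \<in> {x \<in> val ` \<O>. \<nu> \<le> x + \<mu>}" for \<mu>
    unfolding \<gamma>_def
  proof (rule Inf_fin_mem[OF S])
    have "(\<lambda>_. Pinf) \<in> {x \<in> val ` \<O>. \<nu> \<le> x + \<mu>}"
      using as_module.Pinf_mem_val by (simp add: Pinf_add) (simp add: le_fun_def)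
    moreover have "val (a k) \<in> {x \<in> val ` \<O>. \<nu> \<le> x + \<mu>}" if "val (h k) = \<mu>" for k
      using ah(1)[of k] ah(3)[of k] that by simp
    ultimately show "S \<mu> \<subseteq> {x \<in> val ` \<O>. \<nu> \<le> x + \<mu>}"
      unfolding S_def by blast
    fix x y
    assume "x \<in> {x \<in> val ` \<O>. \<nu> \<le> x + \<mu>}" "y \<in> {x \<in> val ` \<O>. \<nu> \<le> x + \<mu>}"
    then show "inf x y \<in> {x \<in> val ` \<O>. \<nu> \<le> x + \<mu>}"
      by (simp add: as_module.inf_mem_val extended_fun_add_inf_distrib)
  qed
  \<comment> \<open>At branch \<open>k\<close> the summand of the generator \<open>val (h k)\<close>
    already drops to \<open>\<nu> k\<close>.\<close>
  have "Inf_fin ((\<lambda>\<mu>. \<gamma> \<mu> + \<mu>) ` val ` H) k \<le> \<nu> k" for k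
  proof -
    have "Inf_fin ((\<lambda>\<mu>. \<gamma> \<mu> + \<mu>) ` val ` H) \<le> \<gamma> (val (h k)) + val (h k)"
      using H(1) ah(2) by (intro Inf_fin.coboundedI) auto
    also have "\<gamma> (val (h k)) \<le> val (a k)"
      unfolding \<gamma>_def by (intro Inf_fin.coboundedI S) (simp add: S_def)
    then have "\<gamma> (val (h k)) + val (h k) \<le> val (a k) + val (h k)"
      by (rule add_right_mono)
    finally have "Inf_fin ((\<lambda>\<mu>. \<gamma> \<mu> + \<mu>) ` val ` H) k \<le> (val (a k) + val (h k)) k"
      by (rule le_funD)
    then show ?thesis
      by (simp only: ah(4))
  qed
  moreover have "\<nu> \<le> Inf_fin ((\<lambda>\<mu>. \<gamma> \<mu> + \<mu>) ` val ` H)"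
    using H(1,3) \<gamma> by (intro Inf_fin.boundedI) auto
  ultimately have "\<nu> = Inf_fin ((\<lambda>\<mu>. \<gamma> \<mu> + \<mu>) ` val ` H)"
    by (intro antisym) (simp_all add: le_funI)
  moreover have "\<gamma> \<in> val ` H \<rightarrow> val ` \<O>"
    using \<gamma> by blast
  ultimately show ?thesis
    by (intro bexI[of _ \<gamma>])
qed

end

section \<open>Fractional ideals, reductions and the generation theorem\<close>

lemma fls_fun_nonzero_divisor_iff:
  fixes h :: "'r \<Rightarrow> 'k::field fls"
  shows "(\<forall>x. h * x = 0 \<longrightarrow> x = 0) \<longleftrightarrow> (\<forall>i. h i \<noteq> 0)"
proof (intro iffI allI)
  fix i
  assume *: "\<forall>x. h * x = 0 \<longrightarrow> x = 0"
  show "h i \<noteq> 0"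
  proof
    assume "h i = 0"
    then have "h * 0(i := 1) = 0"
      by (simp add: fun_eq_iff)
    then have "(0(i := 1)) i = (0 :: 'r \<Rightarrow> 'k fls) i"
      using * by metis
    then show False
      by simp
  qed
qed (auto simp: fun_eq_iff)

text \<open>The conductor is carried from the ring to the ideal by a non zero divisor
  \<open>h\<close>: an element supported on branch \<open>i\<close> is divided by
  \<open>h i\<close>, and the bound is shifted by the order of \<open>h i\<close>.\<close>

lemma (in curve_ring) curve_module_fractional_ideal:
  assumes "fractional_ideal \<O> \<I>"
  shows "curve_module \<O> \<I>"
proof -
  obtain S where S: "finite S" "\<I> = {\<Sum>s\<in>S. a s * s |a. \<forall>s\<in>S. a s \<in> \<O>}"
    using assms unfolding fractional_ideal_def by (elim conjE exE)
  obtain h where h: "h \<in> \<I>" "\<And>i. h i \<noteq> 0"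
    using assms unfolding fractional_ideal_def fls_fun_nonzero_divisor_iff by (elim conjE bexE) simp
  have sum_mem: "(\<Sum>s\<in>S. a s * s) \<in> \<I>" if "\<And>s. s \<in> S \<Longrightarrow> a s \<in> \<O>" for a
    unfolding S(2) using that by blast
  have smult: "g * f \<in> \<I>" if g: "g \<in> \<O>" and f: "f \<in> \<I>" for f g
  proof -
    obtain a where "\<forall>s\<in>S. a s \<in> \<O>" "f = (\<Sum>s\<in>S. a s * s)"
      using f unfolding S(2) by blast
    then show ?thesis
      using g sum_mem[of "\<lambda>s. g * a s"] mult_mem by (simp add: sum_distrib_left mult.assoc)
  qed
  show ?thesis
  proof
    show "0 \<in> \<I>"
      using sum_mem[of "\<lambda>_. 0"] as_module.zero_mem_module by simp
    fix f g
    assume "f \<in> \<I>" "g \<in> \<I>"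
    then obtain a b where "\<forall>s\<in>S. a s \<in> \<O>" "f = (\<Sum>s\<in>S. a s * s)"
      "\<forall>s\<in>S. b s \<in> \<O>" "g = (\<Sum>s\<in>S. b s * s)"
      unfolding S(2) by blast
    then show "f + g \<in> \<I>"
      using sum_mem[of "\<lambda>s. a s + b s"] add_mem by (simp add: distrib_right sum.distrib)
  next
    fix i
    obtain d where d: "\<And>z. fls_order_ge d z \<Longrightarrow> 0(i := z) \<in> \<O>"
      using conductor by blast
    show "\<exists>c. \<forall>z. fls_order_ge c z \<longrightarrow> 0(i := z) \<in> \<I>"
    proof (intro exI allI impI)
      fix z :: "'k fls"
      assume z: "fls_order_ge (d + fls_subdegree (h i)) z"
      have "fls_order_ge d (z / h i)"
        using z h(2)[of i] by (cases "z = 0") (auto simp: fls_order_ge_iff fls_divide_subdegree)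
      then have "0(i := z / h i) * h \<in> \<I>"
        using d smult h(1) by blast
      also have "0(i := z / h i) * h = 0(i := z)"
        using h(2) by (auto simp: fun_eq_iff)
      finally show "0(i := z) \<in> \<I>" .
    qed
  qed (rule smult)
qed

lemma (in curve_ring) power_product_mem:
  assumes "G \<subseteq> \<O>"
  shows "(\<Prod>g\<in>G. g ^ \<alpha> g) \<in> \<O>"
proof -
  have 1: "(1 :: 'r \<Rightarrow> 'k fls) \<in> \<O>"
    using const_mem[of 1] by (simp add: one_fun_def)
  have "g ^ n \<in> \<O>" if "g \<in> \<O>" for g and n :: nat
    using that by (induction n) (simp_all add: 1 mult_mem)
  then show ?thesis
    using assms by (induction G rule: infinite_finite_induct) (simp_all add: 1 mult_mem)
qed

text \<open>The scalar and the \<open>G\<close>-product combine into a single coefficient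
  \<open>a\<close> in the ring.\<close>

lemma (in curve_ring) reductionE:
  assumes "reduction H G f f'" "G \<subseteq> \<O>"
  obtains j a h where "a \<in> \<O>" "h \<in> H" "f' = f - a * h" "val f \<le> val f'" "val f j < val f' j"
proof -
  obtain j where "k_reduction H G j f f'"
    using assms(1) by (auto simp: reduction_def)
  then obtain c h \<alpha> where "h \<in> H" "f' = f - (\<lambda>_. fls_const c) * (\<Prod>g\<in>G. g ^ \<alpha> g) * h"
    "\<forall>i. val f i \<le> val f' i" "val f j < val f' j"
    unfolding k_reduction_def by blast
  moreover have "(\<lambda>_. fls_const c) * (\<Prod>g\<in>G. g ^ \<alpha> g) \<in> \<O>"
    using assms(2) by (intro mult_mem const_mem power_product_mem)
  ultimately show ?thesis
    using that by (simp add: le_fun_def)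
qed

theorem corollary9:
  fixes Q :: "(('n::finite \<Rightarrow> nat) \<Rightarrow> 'k::alg_closed_field) set"
    and M :: "(('n \<Rightarrow> nat) \<Rightarrow> 'k) set set"
    and P :: "'r::finite \<Rightarrow> (('n \<Rightarrow> nat) \<Rightarrow> 'k) set"
    and \<phi> :: "'r \<Rightarrow> (('n \<Rightarrow> nat) \<Rightarrow> 'k) set \<Rightarrow> 'k fls"
    and \<O> \<M> \<I> G H :: "('r \<Rightarrow> 'k fls) set"
    and \<Gamma> :: "('r \<Rightarrow> int extended) set"
  assumes "algebroid_curve Q M P \<phi>"
    and "\<O> = embed P \<phi> ` carrier (mps Quot Q)"
    and "\<M> = embed P \<phi> ` M"
    and "\<Gamma> = val ` \<O>"
    and "fractional_ideal \<O> \<I>"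
    and "standard_basis_ring \<O> \<M> G"
    and "standard_basis_ideal G \<I> H"
  shows "semimodule (value_semiring \<Gamma>) (value_semimodule (val ` \<I>)) \<and>
    finite (val ` H) \<and> val ` H \<subseteq> val ` \<I> \<and>
    (\<forall>\<nu>\<in>val ` \<I>. \<exists>\<gamma>\<in>val ` H \<rightarrow> \<Gamma>.
      \<nu> = (\<Oplus>\<^bsub>value_semimodule (val ` \<I>)\<^esub>\<mu>\<in>val ` H. \<gamma> \<mu> \<odot>\<^bsub>value_semimodule (val ` \<I>)\<^esub> \<mu>) \<and>
      \<nu> = Inf_fin ((\<lambda>\<mu>. \<gamma> \<mu> + \<mu>) ` val ` H))"
proof -
  have curve: "curve_ring \<O>"
    using algebroid_curve.curve_ring_embed[OF assms(1)] assms(2) by simp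
  interpret curve_module \<O> \<I>
    by (rule curve_ring.curve_module_fractional_ideal[OF curve assms(5)])
  have H: "finite H" "H \<subseteq> \<I>"
    using assms(7) unfolding standard_basis_ideal_def by blast+
  have "M \<in> {J. maximalideal J (mps Quot Q)}"
    unfolding algebroid_curve.local_ring[OF assms(1)] by (rule singletonI)
  then have "ideal M (mps Quot Q)"
    by (simp add: maximalideal.axioms(1))
  then have "M \<subseteq> carrier (mps Quot Q)"
    by (intro additive_subgroup.a_subset ideal.axioms(1))
  then have "\<M> \<subseteq> \<O>"
    unfolding assms(2,3) by (rule image_mono)
  moreover have "G \<subseteq> \<M> - {0}"
    using assms(6) unfolding standard_basis_ring_def by (elim conjE)
  ultimately have G: "G \<subseteq> \<O>"
    by blast
  have red: "\<exists>j. \<exists>a\<in>\<O>. \<exists>h\<in>H. val f \<le> val (f - a * h) \<and> val f j < val (f - a * h) j"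
    if f: "f \<in> \<I>" "f \<noteq> 0" for f
  proof -
    obtain f' where "reduction H G f f'"
      using assms(7) f unfolding standard_basis_ideal_def by blast
    then obtain j a h where "a \<in> \<O>" "h \<in> H" "f' = f - a * h" "val f \<le> val f'" "val f j < val f' j"
      using G by (rule reductionE)
    then show ?thesis
      by blast
  qed
  \<comment> \<open>\<open>Inf_fin\<close> requires a nonempty set. The ideal contains a non zero
    divisor, hence a nonzero element, and reducing it uses an element of \<open>H\<close>.\<close>
  obtain f where "f \<in> \<I>" "f \<noteq> 0"
  proof -
    obtain f where "f \<in> \<I>" "\<forall>i. f i \<noteq> 0"
      using assms(5) unfolding fractional_ideal_def fls_fun_nonzero_divisor_iff by (elim conjE bexE)
    then show ?thesis
      by (intro that[of f]) auto
  qed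
  then have "H \<noteq> {}"
    using red[of f] by blast
  have "\<exists>\<gamma>\<in>val ` H \<rightarrow> \<Gamma>.
      \<nu> = (\<Oplus>\<^bsub>value_semimodule (val ` \<I>)\<^esub>\<mu>\<in>val ` H. \<gamma> \<mu> \<odot>\<^bsub>value_semimodule (val ` \<I>)\<^esub> \<mu>) \<and>
      \<nu> = Inf_fin ((\<lambda>\<mu>. \<gamma> \<mu> + \<mu>) ` val ` H)"
    if "\<nu> \<in> val ` \<I>" for \<nu>
  proof -
    have "\<exists>\<gamma>\<in>val ` H \<rightarrow> val ` \<O>. \<nu> = Inf_fin ((\<lambda>\<mu>. \<gamma> \<mu> + \<mu>) ` val ` H)"
      by (rule val_generated[OF H \<open>H \<noteq> {}\<close>]) (fact red, fact \<open>\<nu> \<in> val ` \<I>\<close>)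
    then obtain \<gamma> where \<gamma>: "\<gamma> \<in> val ` H \<rightarrow> val ` \<O>" "\<nu> = Inf_fin ((\<lambda>\<mu>. \<gamma> \<mu> + \<mu>) ` val ` H)"
      by (elim bexE)
    \<comment> \<open>The summands must lie in the carrier for the semimodule sum to agree with the
      infimum.\<close>
    have "(\<lambda>\<mu>. \<gamma> \<mu> + \<mu>) \<in> val ` H \<rightarrow> val ` \<I>"
      using \<gamma>(1) H(2) by (intro funcsetI add_mem_val) auto
    then have "finsum (value_semimodule (val ` \<I>)) (\<lambda>\<mu>. \<gamma> \<mu> + \<mu>) (val ` H) = \<nu>"
      unfolding \<gamma>(2) using H(1) \<open>H \<noteq> {}\<close>
      by (intro finsum_value_semimodule abelian_monoid_value_semimodule Pinf_mem_val inf_mem_val) auto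
    moreover have "smult (value_semimodule (val ` \<I>)) = (+)"
      by (simp add: value_semimodule_def)
    ultimately show ?thesis
      unfolding assms(4) using \<gamma> by (intro bexI[of _ \<gamma>] conjI) (simp_all only:)
  qed
  moreover have "finite (val ` H)" "val ` H \<subseteq> val ` \<I>"
    using H by (simp_all add: image_mono)
  ultimately show ?thesis
    using value_semimodule unfolding assms(4) by (intro conjI ballI)
qed

end
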